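(* Let $s:[0,1]\to[0,1]$ be a linear or expanding Markov map for which there is a set $\{0=\hat x_0<\cdots<\hat x_N=1\}$ such that for every $i=0,\ldots,N$, $s(\hat x_i)=\hat x_j$ for some $0\le j\le N$, and $s$ is monotone on $[\hat x_{i-1},\hat x_i]$ for $i=1,\ldots,N$. Let $s^*$ be its index map and $A^*$ the associated $N\times N$ zero-one matrix. Suppose that $A^*$ is irreducible and $\sum_{i=1}^N A^*_{i,j}>1$ for every $j$. Let $\{a_{i,j}\}$ be an admissible family of slopes, all of the form $\pm2^k$ with $k$ an integer, satisfying $\sum_{i=1}^N A_{i,j}=1$ for every $j$. If the system $$v=Av,\qquad \sum_{i=1}^N v_i=1,\qquad v_i>0\ (i=1,\ldots,N)$$ for $v=(v_1,\ldots,v_N)^T$ has a solution all of whose entries are dyadic, then there exists a unique map $t$ associated with $(s^*,\{a_{i,j}\})$ such that $t$ is expanding Markov, $t\in\mathbb{G}$, and $t$ and $s$ are topologically conjugate.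
   Context: $\lambda$ is Lebesgue measure on $[0,1]$. A continuous map $h:[0,1]\to[0,1]$ is $\lambda$-preserving if $\lambda(A)=\lambda(h^{-1}(A))$ for every Borel set $A\subseteq[0,1]$. A dyadic number is a rational number whose denominator is an integer power of $2$. $\mathbb{G}$ ($\lambda$-preserving Thompson's monoid) is the set of continuous maps $g$ from $[0,1]$ onto $[0,1]$ such that: $g$ is $\lambda$-preserving; $g$ is piecewise affine; $g$ is differentiable except at finitely many points; the $x$-coordinate of each point of non-differentiability is dyadic; and on every interval where $g$ is differentiable, the derivative is of the form $\pm 2^k$ with $k\in\mathbb{Z}$. Continuous maps $s_1,s_2:[0,1]\to[0,1]$ are topologically conjugate if $s_2=h\circ s_1\circ h^{-1}$ for some homeomorphism $h$ of $[0,1]$. A continuous map $s$ is linear Markov if it is piecewise affine and the set of all $s^k(x)$, with $k\ge0$ and $x$ an endpoint of an affine piece, is finite. It is expanding Markov if it is piecewise monotone, the set of all $s^k(x)$, with $k\ge0$ and $x$ an endpoint of a monotone piece, is finite, and there is a constant $c>1$ with $|s(x)-s(y)|\ge c|x-y|$ whenever $x,y$ lie in the same monotone piece. Index map: $s^*:\{0,\ldots,N\}\to\{0,\ldots,N\}$, $s^*(i)=j$ if $s(\hat x_i)=\hat x_j$. Matrix $A^*$ ($N\times N$): $A^*_{i,j}=1$ if $\min(s^*(i-1),s^*(i))<j\le\max(s^*(i-1),s^*(i))$, and $A^*_{i,j}=0$ otherwise. $A^*$ is irreducible if in the directed graph on $1,\ldots,N$ with an arc from $j$ to $i$ iff $A^*_{i,j}=1$,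 every node is reachable from every other node. Admissible family of slopes: real numbers $a_{i,j}\neq0$, for the pairs $(i,j)$ with $A^*_{i,j}=1$, with $a_{i,j}>0$ if $s^*(i-1)<s^*(i)$ and $a_{i,j}<0$ otherwise. The associated non-negative matrix is $A_{i,j}=|a_{i,j}|^{-1}$ if $A^*_{i,j}=1$, and $A_{i,j}=0$ otherwise. A map $t$ is associated with $(s^*,\{a_{i,j}\})$ if $t:[0,1]\to[0,1]$ is continuous and there is a partition $0=x_0<x_1<\cdots<x_N=1$ with $\mathcal{I}_i=[x_{i-1},x_i]$ such that $t(x_i)=x_{s^*(i)}$ for all $i$, $t$ is monotone on each $\mathcal{I}_i$, and $t$ is affine with slope $a_{i,j}$ on $\mathcal{I}_i\cap t^{-1}(\mathcal{I}_j)$ whenever $A^*_{i,j}=1$.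
   Formalization: If s is linear Markov, s is also assumed affine on each [x̂_{i-1}, x̂_i]; without this the claim fails: s(x)=x on [0,1/8], affine from (1/8,1/8) to (1/2,1), 2−2x on [1/2,1], with {0,1/2,1} and slopes ±2, is not conjugate to the tent map. *)

theory Defs
  imports "HOL-Analysis.Analysis"
begin

text \<open>
  A self-map of \<open>[0,1]\<close> is a function on the reals that sends \<open>{0..1}\<close> into itself. None of the
  notions below depends on its values outside \<open>{0..1}\<close>. Derivatives are taken within \<open>{0..1}\<close>,
  so they are one-sided at the endpoints 0 and 1.
\<close>

definition interval_map :: "(real \<Rightarrow> real) \<Rightarrow> bool" where
  "interval_map f \<longleftrightarrow> continuous_on {0..1} f \<and> f \<in> {0..1} \<rightarrow> {0..1}"

definition unit_partition :: "nat \<Rightarrow> (nat \<Rightarrow> real) \<Rightarrow> bool" where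
  "unit_partition n p \<longleftrightarrow> p 0 = 0 \<and> p n = 1 \<and> (\<forall>i<n. p i < p (Suc i))"

definition monotone_fn_on :: "real set \<Rightarrow> (real \<Rightarrow> real) \<Rightarrow> bool" where
  "monotone_fn_on S f \<longleftrightarrow> mono_on S f \<or> antimono_on S f"

definition affine_with_slope_on :: "real \<Rightarrow> real set \<Rightarrow> (real \<Rightarrow> real) \<Rightarrow> bool" where
  "affine_with_slope_on m S f \<longleftrightarrow> (\<exists>c. \<forall>x\<in>S. f x = m * x + c)"

definition affine_fn_on :: "real set \<Rightarrow> (real \<Rightarrow> real) \<Rightarrow> bool" where
  "affine_fn_on S f \<longleftrightarrow> (\<exists>m. affine_with_slope_on m S f)"

definition piecewise_affine :: "(real \<Rightarrow> real) \<Rightarrow> bool" where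
  "piecewise_affine f \<longleftrightarrow>
     (\<exists>n p. unit_partition n p \<and> (\<forall>i\<in>{1..n}. affine_fn_on {p (i - 1)..p i} f))"

definition dyadic :: "real \<Rightarrow> bool" where
  "dyadic x \<longleftrightarrow> (\<exists>(m::int) (k::nat). x = of_int m / 2 ^ k)"

definition signed_power_of_two :: "real \<Rightarrow> bool" where
  "signed_power_of_two d \<longleftrightarrow> (\<exists>k::int. d = 2 powi k \<or> d = - (2 powi k))"

definition lambda_preserving :: "(real \<Rightarrow> real) \<Rightarrow> bool" where
  "lambda_preserving h \<longleftrightarrow>
     (\<forall>A\<in>sets borel. A \<subseteq> {0..1} \<longrightarrow> emeasure lborel A = emeasure lborel (h -` A \<inter> {0..1}))"

definition lambda_Thompson_monoid :: "(real \<Rightarrow> real) set" where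
  "lambda_Thompson_monoid = {g.
     continuous_on {0..1} g \<and> g ` {0..1} = {0..1} \<and>
     lambda_preserving g \<and>
     piecewise_affine g \<and>
     finite {x\<in>{0..1}. \<not> g differentiable (at x within {0..1})} \<and>
     (\<forall>x\<in>{0..1}. \<not> g differentiable (at x within {0..1}) \<longrightarrow> dyadic x) \<and>
     (\<forall>a b. 0 \<le> a \<and> a < b \<and> b \<le> 1 \<and> g differentiable_on {a<..<b} \<longrightarrow>
        (\<exists>d. signed_power_of_two d \<and> (\<forall>x\<in>{a<..<b}. (g has_real_derivative d) (at x))))}"

definition topologically_conjugate :: "(real \<Rightarrow> real) \<Rightarrow> (real \<Rightarrow> real) \<Rightarrow> bool" where
  "topologically_conjugate s1 s2 \<longleftrightarrow>
     (\<exists>h h'. homeomorphism {0..1} {0..1} h h' \<and> (\<forall>x\<in>{0..1}. s2 x = h (s1 (h' x))))"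

text \<open>
  In the two Markov notions the pieces are those of some finite partition. Asking the same of the
  maximal pieces gives an equivalent notion: their endpoints occur in every such partition, and
  expansion on adjacent pieces extends to their union when the map is monotone there.
\<close>

definition linear_markov :: "(real \<Rightarrow> real) \<Rightarrow> bool" where
  "linear_markov s \<longleftrightarrow> interval_map s \<and>
     (\<exists>n p. unit_partition n p \<and>
        (\<forall>i\<in>{1..n}. affine_fn_on {p (i - 1)..p i} s) \<and>
        finite {(s ^^ k) (p i) |k i. i \<le> n})"

definition expanding_markov :: "(real \<Rightarrow> real) \<Rightarrow> bool" where
  "expanding_markov s \<longleftrightarrow> interval_map s \<and>
     (\<exists>n p. unit_partition n p \<and>
        (\<forall>i\<in>{1..n}. monotone_fn_on {p (i - 1)..p i} s) \<and>
        finite {(s ^^ k) (p i) |k i. i \<le> n} \<and>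
        (\<exists>c>1. \<forall>i\<in>{1..n}. \<forall>x\<in>{p (i - 1)..p i}. \<forall>y\<in>{p (i - 1)..p i}.
           \<bar>s x - s y\<bar> \<ge> c * \<bar>x - y\<bar>))"

definition index_map :: "nat \<Rightarrow> (nat \<Rightarrow> real) \<Rightarrow> (real \<Rightarrow> real) \<Rightarrow> nat \<Rightarrow> nat" where
  "index_map N xh s i = (THE j. j \<le> N \<and> s (xh i) = xh j)"

text \<open>
  Matrices and vectors are indexed by \<open>{1..N}\<close>, partition points and index maps by \<open>{0..N}\<close>;
  entries at other indices are never used.
\<close>

definition transition_matrix :: "(nat \<Rightarrow> nat) \<Rightarrow> nat \<Rightarrow> nat \<Rightarrow> nat" where
  "transition_matrix \<sigma> i j =
     (if min (\<sigma> (i - 1)) (\<sigma> i) < j \<and> j \<le> max (\<sigma> (i - 1)) (\<sigma> i) then 1 else 0)"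

definition irreducible_matrix :: "nat \<Rightarrow> (nat \<Rightarrow> nat \<Rightarrow> nat) \<Rightarrow> bool" where
  "irreducible_matrix N B \<longleftrightarrow>
     (\<forall>u\<in>{1..N}. \<forall>w\<in>{1..N}. u \<noteq> w \<longrightarrow>
        (u, w) \<in> {(j, i). i \<in> {1..N} \<and> j \<in> {1..N} \<and> B i j = 1}\<^sup>+)"

definition admissible_slopes :: "nat \<Rightarrow> (nat \<Rightarrow> nat) \<Rightarrow> (nat \<Rightarrow> nat \<Rightarrow> real) \<Rightarrow> bool" where
  "admissible_slopes N \<sigma> a \<longleftrightarrow>
     (\<forall>i\<in>{1..N}. \<forall>j\<in>{1..N}. transition_matrix \<sigma> i j = 1 \<longrightarrow>
        a i j \<noteq> 0 \<and> (if \<sigma> (i - 1) < \<sigma> i then a i j > 0 else a i j < 0))"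

definition slope_matrix :: "(nat \<Rightarrow> nat) \<Rightarrow> (nat \<Rightarrow> nat \<Rightarrow> real) \<Rightarrow> nat \<Rightarrow> nat \<Rightarrow> real" where
  "slope_matrix \<sigma> a i j = (if transition_matrix \<sigma> i j = 1 then inverse \<bar>a i j\<bar> else 0)"

definition associated_map ::
  "nat \<Rightarrow> (nat \<Rightarrow> nat) \<Rightarrow> (nat \<Rightarrow> nat \<Rightarrow> real) \<Rightarrow> (real \<Rightarrow> real) \<Rightarrow> bool" where
  "associated_map N \<sigma> a t \<longleftrightarrow> interval_map t \<and>
     (\<exists>x. unit_partition N x \<and>
        (\<forall>i\<le>N. t (x i) = x (\<sigma> i)) \<and>
        (\<forall>i\<in>{1..N}. monotone_fn_on {x (i - 1)..x i} t) \<and>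
        (\<forall>i\<in>{1..N}. \<forall>j\<in>{1..N}. transition_matrix \<sigma> i j = 1 \<longrightarrow>
           affine_with_slope_on (a i j) ({x (i - 1)..x i} \<inter> t -` {x (j - 1)..x j}) t))"

end

theory Submission
  imports Defs
begin

text \<open>
  Put \<open>x k = v 1 + \<dots> + v k\<close>. On the \<open>i\<close>-th piece the map \<open>t\<close> is, up to orientation, the inverse of the
  piecewise linear function with slope \<open>1/\<bar>a i j\<bar>\<close> on the \<open>j\<close>-th piece; it fills the \<open>i\<close>-th piece exactly
  because \<open>v = A v\<close>. The column sums of \<open>A\<close> make \<open>t\<close> preserve Lebesgue measure, and, as every column has
  at least two non-zero entries, they force all slopes to be at least 2 in absolute value. Any
  associated map has piece lengths that solve \<open>v = A v\<close>, and irreducibility makes that solution unique.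

  For the conjugacy, a semiconjugacy \<open>h\<close> from \<open>f\<close> to \<open>g\<close> that matches the pieces is a fixed point of
  pulling back along the inverse branches of \<open>g\<close>. This operator is a contraction when \<open>g\<close> expands, so \<open>h\<close>
  exists and is unique; applied in both directions, uniqueness makes the two semiconjugacies mutually
  inverse. If \<open>s\<close> is only linear Markov, irreducibility yields weights on the pieces for which it expands.
\<close>

section \<open>Partitions and piecewise linear functions\<close>

text \<open>The break points of \<open>t\<close> are preimages under \<open>t\<close> itself and are
  not known in advance, whereas the inverse of a branch breaks only at the points
  \<open>x j\<close>. Hence \<open>t\<close> is built, and any rival of it is analysed, through
  these inverses. The obstacle to conjugacy for a linear Markov \<open>s\<close> is that some slopes
  may have modulus at most 1. Column sums above 1 force some branch to cover two or more pieces, and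
  irreducibility lets every piece reach such a branch in boundedly many steps. The gain made there
  is spread over the waiting time by taking a root, at the price of weighting the pieces. The
  partition of a rival is unknown, so the equation \<open>v = A v\<close> has to be derived from its
  slopes before a Perron-Frobenius argument can compare lengths. The slope of \<open>t\<close> can
  change only at preimages of partition points. They form a finite set that \<open>t\<close> maps
  into itself, whence the Markov property; walking through them from 0 shows that they are
  dyadic.\<close>

lemma unit_partition_less:
  assumes "unit_partition N x" "i < j" "j \<le> N"
  shows "x i < x j"
  using assms(2,3)
proof (induction j)
  case (Suc j)
  have "x j < x (Suc j)" using assms(1) Suc.prems by (auto simp: unit_partition_def)
  then show ?case using Suc by (cases "i = j") auto
qed simp

lemma unit_partition_le:
  assumes "unit_partition N x" "i \<le> j" "j \<le> N"
  shows "x i \<le> x j"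
  using unit_partition_less[OF assms(1), of i j] assms by (cases "i = j") auto

lemma unit_partition_eq_iff:
  assumes "unit_partition N x" "i \<le> N" "j \<le> N"
  shows "x i = x j \<longleftrightarrow> i = j"
  using unit_partition_less[OF assms(1), of i j] unit_partition_less[OF assms(1), of j i] assms
  by (cases i j rule: linorder_cases) auto

lemma unit_partition_le_iff:
  assumes "unit_partition N x" "i \<le> N" "j \<le> N"
  shows "x i \<le> x j \<longleftrightarrow> i \<le> j"
  using unit_partition_less[OF assms(1), of j i] unit_partition_le[OF assms(1), of i j] assms
  by (cases "i \<le> j") auto

lemma unit_partition_bounds:
  assumes "unit_partition N x" "i \<le> N"
  shows "0 \<le> x i" "x i \<le> 1"
  using unit_partition_le[OF assms(1), of 0 i] unit_partition_le[OF assms(1), of i N] assms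
  by (auto simp: unit_partition_def)

lemma unit_partition_pos: "unit_partition N x \<Longrightarrow> 0 < N"
  by (cases N) (auto simp: unit_partition_def)

lemma unit_partition_step:
  assumes "unit_partition N x" "i \<in> {1..N}"
  shows "x (i - 1) < x i"
  using unit_partition_less[OF assms(1), of "i - 1" i] assms(2) by auto

lemma unit_partition_piece_subset:
  assumes "unit_partition N x" "i \<in> {1..N}"
  shows "{x (i - 1)..x i} \<subseteq> {0..1}"
  using unit_partition_bounds[OF assms(1), of i] unit_partition_bounds[OF assms(1), of "i - 1"] assms(2)
  by auto

text \<open>The right end is excluded so that the piece found leaves room to the right of
  \<open>z\<close>; strict monotonicity and refinement arguments need that room.\<close>

lemma partition_cover_half_open:
  fixes x :: "nat \<Rightarrow> real"
  assumes "m < M" "x m \<le> z" "z < x M"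
  shows "\<exists>j. m < j \<and> j \<le> M \<and> x (j - 1) \<le> z \<and> z < x j"
  using assms
proof (induction M)
  case (Suc M)
  show ?case
  proof (cases "z < x M")
    case True
    then have "m < M" using Suc.prems by (cases "m = M") auto
    then show ?thesis using Suc True by (meson le_SucI)
  next
    case False
    then show ?thesis using Suc.prems by (intro exI[of _ "Suc M"]) auto
  qed
qed simp

lemma partition_cover:
  fixes x :: "nat \<Rightarrow> real"
  assumes "m < M" "x m \<le> z" "z \<le> x M" "x (M - 1) \<le> x M"
  shows "\<exists>j. m < j \<and> j \<le> M \<and> z \<in> {x (j - 1)..x j}"
proof (cases "z = x M")
  case True
  then show ?thesis using assms by (intro exI[of _ M]) auto
next
  case False
  then show ?thesis using partition_cover_half_open[of m M x z] assms by fastforce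
qed

lemma unit_partition_cover:
  assumes "unit_partition N x" "z \<in> {0..1}"
  obtains i where "i \<in> {1..N}" "z \<in> {x (i - 1)..x i}"
proof -
  have N: "0 < N" "x 0 = 0" "x N = 1"
    using unit_partition_pos[OF assms(1)] assms(1) by (auto simp: unit_partition_def)
  obtain i where "0 < i" "i \<le> N" "z \<in> {x (i - 1)..x i}"
    using partition_cover[of 0 N x z] N assms unit_partition_le[OF assms(1), of "N - 1" N] by auto
  then show thesis using that[of i] by auto
qed

lemma unit_partition_Union:
  assumes "unit_partition N x"
  shows "(\<Union>i\<in>{1..N}. {x (i - 1)..x i}) = {0..1}"
proof
  show "(\<Union>i\<in>{1..N}. {x (i - 1)..x i}) \<subseteq> {0..1}"
    using unit_partition_piece_subset[OF assms] by blast
  show "{0..1} \<subseteq> (\<Union>i\<in>{1..N}. {x (i - 1)..x i})"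
  proof
    fix z :: real assume "z \<in> {0..1}"
    from unit_partition_cover[OF assms this] show "z \<in> (\<Union>i\<in>{1..N}. {x (i - 1)..x i})" by blast
  qed
qed

text \<open>Neighbouring pieces share an endpoint, where independent choices could clash. The values
  \<open>q k\<close> are therefore prescribed there and must suit both sides, while an interior
  point lies in one piece only and any witness will do.\<close>

lemma piecewise_choice:
  assumes part: "unit_partition N x"
    and point: "\<And>k i. k \<le> N \<Longrightarrow> i \<in> {1..N} \<Longrightarrow> k = i - 1 \<or> k = i \<Longrightarrow> P i (x k) (q k)"
    and inside: "\<And>i z. i \<in> {1..N} \<Longrightarrow> x (i - 1) < z \<Longrightarrow> z < x i \<Longrightarrow> \<exists>w. P i z w"
  shows "\<exists>t. (\<forall>k\<le>N. t (x k) = q k) \<and> (\<forall>i\<in>{1..N}. \<forall>z\<in>{x (i - 1)..x i}. P i z (t z))"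
proof -
  have "\<exists>w. (\<forall>k\<le>N. z = x k \<longrightarrow> w = q k) \<and> (\<forall>i\<in>{1..N}. z \<in> {x (i - 1)..x i} \<longrightarrow> P i z w)" for z
  proof (cases "\<exists>k\<le>N. z = x k")
    case True
    then obtain k where k: "k \<le> N" "z = x k" by auto
    have "P i z (q k)" if i: "i \<in> {1..N}" "z \<in> {x (i - 1)..x i}" for i
    proof -
      have "i - 1 \<le> k" "k \<le> i"
        using i k unit_partition_le_iff[OF part, of "i - 1" k] unit_partition_le_iff[OF part, of k i]
        by auto
      then have "k = i - 1 \<or> k = i" by linarith
      from point[OF k(1) i(1) this] show ?thesis using k(2) by simp
    qed
    moreover have "q k = q l" if "l \<le> N" "z = x l" for l
      using unit_partition_eq_iff[OF part k(1) that(1)] k(2) that(2) by simp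
    ultimately show ?thesis by blast
  next
    case False
    show ?thesis
    proof (cases "\<exists>i\<in>{1..N}. z \<in> {x (i - 1)..x i}")
      case True
      then obtain i where i: "i \<in> {1..N}" "z \<in> {x (i - 1)..x i}" by blast
      have "i - 1 \<le> N" "i \<le> N" using i(1) by auto
      then have "z \<noteq> x (i - 1)" "z \<noteq> x i" using False by blast+
      then obtain w where w: "P i z w" using inside[OF i(1), of z] i(2) by auto
      have only: "l = i" if l: "l \<in> {1..N}" "z \<in> {x (l - 1)..x l}" for l
      proof (cases l i rule: linorder_cases)
        case less
        then have "x l \<le> x (i - 1)" using unit_partition_le[OF part, of l "i - 1"] i by auto
        then have "z = x l" using l i by auto
        then show ?thesis using False l by auto
      next
        case greater
        then have "x i \<le> x (l - 1)" using unit_partition_le[OF part, of i "l - 1"] l by auto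
        then have "z = x i" using l i by auto
        then show ?thesis using False i by auto
      qed
      have "P l z w" if "l \<in> {1..N}" "z \<in> {x (l - 1)..x l}" for l
        using only[OF that] w by simp
      then show ?thesis using False by blast
    qed (use False in blast)
  qed
  then obtain t where t: "\<And>z k. k \<le> N \<Longrightarrow> z = x k \<Longrightarrow> t z = q k"
    "\<And>z i. i \<in> {1..N} \<Longrightarrow> z \<in> {x (i - 1)..x i} \<Longrightarrow> P i z (t z)" by metis
  show ?thesis by (intro exI[of _ t] conjI allI impI ballI t refl)
qed

lemma continuous_on_unit_partition:
  fixes f :: "real \<Rightarrow> real"
  assumes "unit_partition N x" "\<And>i. i \<in> {1..N} \<Longrightarrow> continuous_on {x (i - 1)..x i} f"
  shows "continuous_on {0..1} f"
  unfolding unit_partition_Union[OF assms(1), symmetric]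
  by (rule continuous_on_closed_Union) (use assms(2) in auto)

lemma sum_partition_telescope:
  fixes x :: "nat \<Rightarrow> real"
  shows "m \<le> k \<Longrightarrow> (\<Sum>j=m+1..k. x j - x (j - 1)) = x k - x m"
proof (induction k)
  case (Suc k)
  then show ?case by (cases "m = Suc k") auto
qed simp

lemma monotone_fn_onD:
  assumes "monotone_fn_on {a..b} f" "a \<le> z" "z \<le> b"
  shows "min (f a) (f b) \<le> f z \<and> f z \<le> max (f a) (f b)"
proof -
  have m: "z \<in> {a..b}" "a \<in> {a..b}" "b \<in> {a..b}" using assms by auto
  consider "mono_on {a..b} f" | "antimono_on {a..b} f"
    using assms(1) by (auto simp: monotone_fn_on_def)
  then show ?thesis
  proof cases
    case 1
    show ?thesis using monotone_onD[OF 1 m(2,1) assms(2)] monotone_onD[OF 1 m(1,3) assms(3)] by auto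
  next
    case 2
    show ?thesis using monotone_onD[OF 2 m(2,1) assms(2)] monotone_onD[OF 2 m(1,3) assms(3)] by auto
  qed
qed

text \<open>Splitting at a point of \<open>F\<close> leaves fewer points of \<open>F\<close> inside
  either half, so a relation known on intervals free of \<open>F\<close> spreads by transitivity. It
  serves for expansion estimates, increments and derivatives alike.\<close>

lemma chain_interval:
  fixes a b :: real
  assumes "finite F" and "a < b"
    and base: "\<And>y z. a \<le> y \<Longrightarrow> y < z \<Longrightarrow> z \<le> b \<Longrightarrow> F \<inter> {y<..<z} = {} \<Longrightarrow> R y z"
    and trans: "\<And>y z w. a \<le> y \<Longrightarrow> y < z \<Longrightarrow> z < w \<Longrightarrow> w \<le> b \<Longrightarrow> R y z \<Longrightarrow> R z w \<Longrightarrow> R y w"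
  shows "R a b"
proof -
  have "R y z" if "a \<le> y" "y < z" "z \<le> b" for y z
    using that
  proof (induction "card (F \<inter> {y<..<z})" arbitrary: y z rule: less_induct)
    case less
    show ?case
    proof (cases "F \<inter> {y<..<z} = {}")
      case False
      then obtain q where q: "q \<in> F" "y < q" "q < z" by auto
      have "F \<inter> {y<..<q} \<subset> F \<inter> {y<..<z}" "F \<inter> {q<..<z} \<subset> F \<inter> {y<..<z}" using q by auto
      then have "card (F \<inter> {y<..<q}) < card (F \<inter> {y<..<z})"
        "card (F \<inter> {q<..<z}) < card (F \<inter> {y<..<z})"
        using assms(1) by (auto intro!: psubset_card_mono)
      then have "R y q" "R q z" using less q by auto
      then show ?thesis using trans[of y q z] less.prems q by auto
    qed (use base less.prems in blast)
  qed
  then show ?thesis using assms(2) by auto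
qed

text \<open>For a partition \<open>x\<close> of the unit interval this is the integral from 0 to
  \<open>w\<close> of the step function with value \<open>c j\<close> on the \<open>j\<close>-th
  piece: the factor of \<open>c j\<close> is the length of the part of that piece left of
  \<open>w\<close>. In this form continuity and monotonicity hold term by term, without a case split
  on the piece containing \<open>w\<close>.\<close>

definition pl :: "nat \<Rightarrow> (nat \<Rightarrow> real) \<Rightarrow> (nat \<Rightarrow> real) \<Rightarrow> real \<Rightarrow> real" where
  "pl N x c w = (\<Sum>j=1..N. c j * max 0 (min w (x j) - x (j - 1)))"

lemma continuous_on_pl: "continuous_on S (pl N x c)"
  unfolding pl_def by (intro continuous_intros)

lemma pl_piece:
  assumes "unit_partition N x" "j \<in> {1..N}"
    and "w \<in> {x (j - 1)..x j}" "w' \<in> {x (j - 1)..x j}"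
  shows "pl N x c w - pl N x c w' = c j * (w - w')"
proof -
  have *: "max 0 (min w (x i) - x (i - 1)) - max 0 (min w' (x i) - x (i - 1))
      = (if i = j then w - w' else 0)" if "i \<in> {1..N}" for i
  proof (cases i j rule: linorder_cases)
    case less
    then have "x i \<le> x (j - 1)" using unit_partition_le[OF assms(1), of i "j - 1"] assms(2) by auto
    then show ?thesis using less assms by auto
  next
    case greater
    then have "x j \<le> x (i - 1)" using unit_partition_le[OF assms(1), of j "i - 1"] that by auto
    then show ?thesis using greater assms by auto
  qed (use assms in auto)
  have "pl N x c w - pl N x c w' = (\<Sum>i=1..N. c i * (if i = j then w - w' else 0))"
    unfolding pl_def sum_subtractf[symmetric] right_diff_distrib[symmetric]
    by (intro sum.cong refl) (subst *, auto)
  also have "\<dots> = c j * (w - w')" using assms(2) by (simp add: if_distrib cong: if_cong)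
  finally show ?thesis .
qed

lemma pl_at:
  assumes "unit_partition N x" "k \<le> N"
  shows "pl N x c (x k) = (\<Sum>j=1..k. c j * (x j - x (j - 1)))"
proof -
  have "pl N x c (x k) = (\<Sum>j=1..N. if j \<le> k then c j * (x j - x (j - 1)) else 0)"
    unfolding pl_def
  proof (rule sum.cong[OF refl])
    fix j assume j: "j \<in> {1..N}"
    have "x (j - 1) \<le> x j" using unit_partition_step[OF assms(1) j] by simp
    moreover have "x j \<le> x k" if "j \<le> k" using unit_partition_le[OF assms(1) that assms(2)] .
    moreover have "x k \<le> x (j - 1)" if "\<not> j \<le> k"
      using unit_partition_le[OF assms(1), of k "j - 1"] that j by auto
    ultimately show "c j * max 0 (min (x k) (x j) - x (j - 1))
        = (if j \<le> k then c j * (x j - x (j - 1)) else 0)" by auto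
  qed
  also have "\<dots> = (\<Sum>j\<in>{1..N} \<inter> {j. j \<le> k}. c j * (x j - x (j - 1)))"
    by (simp add: sum.If_cases)
  also have "{1..N} \<inter> {j. j \<le> k} = {1..k}" using assms(2) by auto
  finally show ?thesis .
qed

lemma pl_mono:
  assumes "\<And>j. j \<in> {1..N} \<Longrightarrow> 0 \<le> c j" "w \<le> w'"
  shows "pl N x c w \<le> pl N x c w'"
  unfolding pl_def using assms by (intro sum_mono mult_left_mono) auto

text \<open>A row of the slope matrix vanishes off the pieces that its branch covers, so strictness
  can be expected only between \<open>x m\<close> and \<open>x M\<close>.\<close>

lemma pl_strict_mono:
  assumes x: "unit_partition N x" and c: "\<And>j. j \<in> {1..N} \<Longrightarrow> 0 \<le> c j"
    and pos: "\<And>j. m < j \<Longrightarrow> j \<le> M \<Longrightarrow> 0 < c j" and M: "M \<le> N"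
    and w: "x m \<le> w" "w < w'" "w' \<le> x M" "m \<le> M"
  shows "pl N x c w < pl N x c w'"
proof -
  have "m < M" using w by (cases "m = M") auto
  then obtain j where j: "m < j" "j \<le> M" "x (j - 1) \<le> w" "w < x j"
    using partition_cover_half_open[of m M x w] w by auto
  have jN: "j \<in> {1..N}" using j M by auto
  \<comment> \<open>Cutting \<open>w'\<close> off at the end of the piece of \<open>w\<close> gives
    strict growth inside one piece; beyond it weak monotonicity suffices.\<close>
  let ?w = "min w' (x j)"
  have "pl N x c ?w - pl N x c w = c j * (?w - w)"
    by (rule pl_piece[OF x jN]) (use j w in auto)
  moreover have "c j * (?w - w) > 0" using pos[of j] j w by auto
  moreover have "pl N x c ?w \<le> pl N x c w'" by (rule pl_mono) (use c in auto)
  ultimately show ?thesis by linarith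
qed

section \<open>Conjugacy of expanding systems\<close>

text \<open>
  The weights \<open>u\<close> rescale each piece, so that the system expands by \<open>inverse \<kappa>\<close> after rescaling; a linear
  Markov map need not expand in the Euclidean metric.
\<close>

locale expanding_system =
  fixes N :: nat and \<sigma> :: "nat \<Rightarrow> nat" and x :: "nat \<Rightarrow> real" and f :: "real \<Rightarrow> real"
    and u :: "nat \<Rightarrow> real" and \<kappa> :: real
  assumes part: "unit_partition N x"
    and cont: "continuous_on {0..1} f"
    and index_le: "\<And>i. i \<le> N \<Longrightarrow> \<sigma> i \<le> N"
    and index_neq: "\<And>i. i \<in> {1..N} \<Longrightarrow> \<sigma> (i - 1) \<noteq> \<sigma> i"
    and f_point: "\<And>i. i \<le> N \<Longrightarrow> f (x i) = x (\<sigma> i)"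
    and f_mono: "\<And>i. i \<in> {1..N} \<Longrightarrow> monotone_fn_on {x (i - 1)..x i} f"
    and u_pos: "\<And>i. i \<in> {1..N} \<Longrightarrow> 0 < u i"
    and rate: "0 < \<kappa>" "\<kappa> < 1"
    and contract: "\<And>i j y z. i \<in> {1..N} \<Longrightarrow> j \<in> {1..N} \<Longrightarrow> transition_matrix \<sigma> i j = 1 \<Longrightarrow>
       y \<in> {x (i - 1)..x i} \<Longrightarrow> z \<in> {x (i - 1)..x i} \<Longrightarrow>
       f y \<in> {x (j - 1)..x j} \<Longrightarrow> f z \<in> {x (j - 1)..x j} \<Longrightarrow>
       \<bar>y - z\<bar> * u j \<le> \<kappa> * u i * \<bar>f y - f z\<bar>"

lemma transition_matrix_eq_1_iff:
  "transition_matrix \<sigma> i j = 1 \<longleftrightarrow> min (\<sigma> (i - 1)) (\<sigma> i) < j \<and> j \<le> max (\<sigma> (i - 1)) (\<sigma> i)"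
  unfolding transition_matrix_def by simp

text \<open>Monotonicity traps \<open>f z\<close> between the images of the endpoints, which are
  partition points, and the pieces between them are exactly the ones in row \<open>i\<close>;
  distinct indices make this range nonempty. It is kept outside the locales because both kinds of
  system use it.\<close>

lemma image_piece:
  assumes part: "unit_partition N x"
    and le: "\<And>i. i \<le> N \<Longrightarrow> \<sigma> i \<le> N"
    and neq: "\<And>i. i \<in> {1..N} \<Longrightarrow> \<sigma> (i - 1) \<noteq> \<sigma> i"
    and pt: "\<And>i. i \<le> N \<Longrightarrow> f (x i) = x (\<sigma> i)"
    and mono: "\<And>i. i \<in> {1..N} \<Longrightarrow> monotone_fn_on {x (i - 1)..x i} f"
    and i: "i \<in> {1..N}" and z: "z \<in> {x (i - 1)..x i}"
  obtains j where "j \<in> {1..N}" "transition_matrix \<sigma> i j = 1" "f z \<in> {x (j - 1)..x j}"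
proof -
  let ?m = "min (\<sigma> (i - 1)) (\<sigma> i)" and ?M = "max (\<sigma> (i - 1)) (\<sigma> i)"
  have N: "\<sigma> (i - 1) \<le> N" "\<sigma> i \<le> N" using le[of i] le[of "i - 1"] i by auto
  have p: "f (x (i - 1)) = x (\<sigma> (i - 1))" "f (x i) = x (\<sigma> i)" using pt[of i] pt[of "i - 1"] i by auto
  have mM: "?m < ?M" using neq[OF i] by auto
  have b: "min (x (\<sigma> (i - 1))) (x (\<sigma> i)) \<le> f z" "f z \<le> max (x (\<sigma> (i - 1))) (x (\<sigma> i))"
    using monotone_fn_onD[OF mono[OF i], of z] z p by auto
  have "x ?m = min (x (\<sigma> (i - 1))) (x (\<sigma> i)) \<and> x ?M = max (x (\<sigma> (i - 1))) (x (\<sigma> i))"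
    using unit_partition_le_iff[OF part N] unit_partition_le_iff[OF part N(2,1)]
    by (auto simp: min_def max_def)
  with b have "x ?m \<le> f z" "f z \<le> x ?M" by auto
  moreover have "x (?M - 1) \<le> x ?M" using unit_partition_le[OF part, of "?M - 1" ?M] N by auto
  ultimately obtain j where j: "?m < j" "j \<le> ?M" "f z \<in> {x (j - 1)..x j}"
    using partition_cover[OF mM, of x "f z"] by blast
  show thesis
  proof (rule that)
    show "j \<in> {1..N}" using j N by auto
    show "transition_matrix \<sigma> i j = 1" using j unfolding transition_matrix_eq_1_iff by blast
  qed (use j in auto)
qed

context expanding_system
begin

lemma image_in_piece:
  assumes "i \<in> {1..N}" "z \<in> {x (i - 1)..x i}"
  obtains j where "j \<in> {1..N}" "transition_matrix \<sigma> i j = 1" "f z \<in> {x (j - 1)..x j}"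
  using image_piece[OF part index_le index_neq f_point f_mono assms] by blast

lemma maps_unit:
  assumes "z \<in> {0..1}"
  shows "f z \<in> {0..1}"
proof -
  obtain i where i: "i \<in> {1..N}" "z \<in> {x (i - 1)..x i}" using unit_partition_cover[OF part assms] .
  obtain j where "j \<in> {1..N}" "f z \<in> {x (j - 1)..x j}" using image_in_piece[OF i] .
  then show ?thesis using unit_partition_piece_subset[OF part] by blast
qed

text \<open>Two points with the same image have a target piece in common, so \<open>contract\<close>
  applies with right-hand side 0.\<close>

lemma inj_on_piece:
  assumes i: "i \<in> {1..N}"
  shows "inj_on f {x (i - 1)..x i}"
proof (rule inj_onI)
  fix y z assume y: "y \<in> {x (i - 1)..x i}" and z: "z \<in> {x (i - 1)..x i}" and eq: "f y = f z"
  obtain j where j: "j \<in> {1..N}" "transition_matrix \<sigma> i j = 1" "f y \<in> {x (j - 1)..x j}"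
    using image_in_piece[OF i y] by blast
  have "\<bar>y - z\<bar> * u j \<le> 0" using contract[OF i j(1,2) y z j(3)] j(3) eq by simp
  then show "y = z" using u_pos[OF j(1)] by (simp add: mult_le_0_iff)
qed

lemma piece_covers:
  assumes i: "i \<in> {1..N}" and j: "j \<in> {1..N}" "transition_matrix \<sigma> i j = 1"
    and w: "w \<in> {x (j - 1)..x j}"
  shows "\<exists>z\<in>{x (i - 1)..x i}. f z = w"
proof -
  let ?a = "\<sigma> (i - 1)" and ?b = "\<sigma> i"
  have N: "?a \<le> N" "?b \<le> N" using index_le[of i] index_le[of "i - 1"] i by auto
  have p: "f (x (i - 1)) = x ?a" "f (x i) = x ?b" using f_point[of i] f_point[of "i - 1"] i by auto
  have le: "x (i - 1) \<le> x i" using unit_partition_step[OF part i] by simp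
  have c: "continuous_on {x (i - 1)..x i} f"
    using continuous_on_subset[OF cont unit_partition_piece_subset[OF part i]] .
  have tr: "min ?a ?b < j" "j \<le> max ?a ?b" using j(2) unfolding transition_matrix_eq_1_iff by blast+
  show ?thesis
  proof (cases "?a < ?b")
    case True
    then have "?a \<le> j - 1" "j \<le> ?b" using tr by auto
    then have "x ?a \<le> x (j - 1)" "x j \<le> x ?b" using unit_partition_le[OF part] N j by auto
    then show ?thesis using IVT'[OF _ _ le c, of w] w p by auto
  next
    case False
    then have "?b \<le> j - 1" "j \<le> ?a" using tr by auto
    then have "x ?b \<le> x (j - 1)" "x j \<le> x ?a" using unit_partition_le[OF part] N j by auto
    then show ?thesis using IVT2'[OF _ _ le c, of w] w p by auto
  qed
qed

end

text \<open>The inclusions of pieces ensure that a branch of the target map can be inverted at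
  \<open>h (f z)\<close>; the values at partition points make the results agree where two pieces
  meet.\<close>

definition adapted :: "nat \<Rightarrow> (nat \<Rightarrow> real) \<Rightarrow> (nat \<Rightarrow> real) \<Rightarrow> (real \<Rightarrow> real) \<Rightarrow> bool" where
  "adapted N x y h \<longleftrightarrow> continuous_on {0..1} h \<and> (\<forall>k\<le>N. h (x k) = y k) \<and>
     (\<forall>i\<in>{1..N}. h ` {x (i - 1)..x i} \<subseteq> {y (i - 1)..y i})"

lemma piecewise_maps_unit:
  assumes "unit_partition N x" "unit_partition N y"
    and "\<And>i. i \<in> {1..N} \<Longrightarrow> h ` {x (i - 1)..x i} \<subseteq> {y (i - 1)..y i}" and "z \<in> {0..1}"
  shows "h z \<in> {0..1}"
proof -
  obtain i where i: "i \<in> {1..N}" "z \<in> {x (i - 1)..x i}" using unit_partition_cover[OF assms(1,4)] .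
  then show ?thesis using assms(3)[OF i(1)] unit_partition_piece_subset[OF assms(2) i(1)] by blast
qed

text \<open>The starting point of the iteration is piecewise linear, with the ratios of piece
  lengths as slopes.\<close>

lemma adapted_exists:
  assumes x: "unit_partition N x" and y: "unit_partition N y"
  shows "\<exists>h. adapted N x y h"
proof -
  let ?c = "\<lambda>j. (y j - y (j - 1)) / (x j - x (j - 1))"
  let ?h = "pl N x ?c"
  have c: "0 \<le> ?c j" if "j \<in> {1..N}" for j
    using unit_partition_step[OF x that] unit_partition_step[OF y that] by simp
  have at: "?h (x k) = y k" if "k \<le> N" for k
  proof -
    have "?h (x k) = (\<Sum>j=1..k. y j - y (j - 1))"
      unfolding pl_at[OF x that]
    proof (rule sum.cong[OF refl])
      fix j assume "j \<in> {1..k}"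
      then show "?c j * (x j - x (j - 1)) = y j - y (j - 1)"
        using unit_partition_step[OF x, of j] that by auto
    qed
    then show ?thesis using sum_partition_telescope[of 0 k y] y by (simp add: unit_partition_def)
  qed
  have "?h z \<in> {y (i - 1)..y i}" if i: "i \<in> {1..N}" and z: "z \<in> {x (i - 1)..x i}" for i z
    using pl_mono[of N ?c "x (i - 1)" z x, OF c] pl_mono[of N ?c z "x i" x, OF c]
      at[of i] at[of "i - 1"] i z by auto
  then show ?thesis using at continuous_on_pl[of "{0..1}" N x ?c]
    by (intro exI[of _ ?h]) (auto simp: adapted_def)
qed

text \<open>
  A semiconjugacy is a fixed point of \<open>h \<mapsto> g\<^sub>i\<inverse> \<circ> h \<circ> f\<close> on the \<open>i\<close>-th piece, where \<open>g\<^sub>i\<close> is the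
  \<open>i\<close>-th branch of \<open>g\<close>; this operator contracts by \<open>\<kappa>\<close> in the weighted supremum norm.
\<close>

locale two_systems = f: expanding_system N \<sigma> x f uf \<kappa>f + g: expanding_system N \<sigma> y g ug \<kappa>g
  for N \<sigma> x f uf \<kappa>f y g ug \<kappa>g
begin

text \<open>If \<open>f z\<close> lies in piece \<open>j\<close>, so does \<open>h (f z)\<close> on
  the other side, and the \<open>i\<close>-th branch of \<open>g\<close> covers that piece because
  both systems share \<sigma>. On each piece \<open>h'\<close> is an inverse branch composed with
  \<open>h\<close> and \<open>f\<close>, and the inverse is continuous because the piece is
  compact.\<close>

lemma pull_back:
  assumes h: "adapted N x y h"
  shows "\<exists>h'. adapted N x y h' \<and> (\<forall>z\<in>{0..1}. g (h' z) = h (f z))"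
proof -
  have hk: "h (x k) = y k" if "k \<le> N" for k using h that by (auto simp: adapted_def)
  have ex: "\<exists>w\<in>{y (i - 1)..y i}. g w = h (f z)" if i: "i \<in> {1..N}" and z: "z \<in> {x (i - 1)..x i}" for i z
  proof -
    obtain j where j: "j \<in> {1..N}" "transition_matrix \<sigma> i j = 1" "f z \<in> {x (j - 1)..x j}"
      using f.image_in_piece[OF i z] by blast
    have "h (f z) \<in> {y (j - 1)..y j}" using h j by (auto simp: adapted_def image_subset_iff)
    then show ?thesis using g.piece_covers[OF i j(1,2)] by blast
  qed
  have "\<exists>h'. (\<forall>k\<le>N. h' (x k) = y k) \<and>
      (\<forall>i\<in>{1..N}. \<forall>z\<in>{x (i - 1)..x i}. h' z \<in> {y (i - 1)..y i} \<and> g (h' z) = h (f z))"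
  proof (rule piecewise_choice[OF f.part])
    fix k i assume k: "k \<le> N" and i: "i \<in> {1..N}" "k = i - 1 \<or> k = i"
    have "y k \<in> {y (i - 1)..y i}" using unit_partition_step[OF g.part i(1)] i(2) by auto
    moreover have "g (y k) = h (f (x k))"
      using f.f_point[OF k] g.f_point[OF k] hk[OF f.index_le[OF k]] by simp
    ultimately show "y k \<in> {y (i - 1)..y i} \<and> g (y k) = h (f (x k))" ..
  next
    fix i z assume "i \<in> {1..N}" "x (i - 1) < z" "z < x i"
    then show "\<exists>w. w \<in> {y (i - 1)..y i} \<and> g w = h (f z)" using ex[of i z] by auto
  qed
  then obtain h' where h': "\<And>k. k \<le> N \<Longrightarrow> h' (x k) = y k"
    "\<And>z i. i \<in> {1..N} \<Longrightarrow> z \<in> {x (i - 1)..x i} \<Longrightarrow> h' z \<in> {y (i - 1)..y i}"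
    "\<And>z i. i \<in> {1..N} \<Longrightarrow> z \<in> {x (i - 1)..x i} \<Longrightarrow> g (h' z) = h (f z)"
    by blast
  have sub: "z \<in> {0..1}" if "i \<in> {1..N}" "z \<in> {x (i - 1)..x i}" for i z
    using unit_partition_piece_subset[OF f.part that(1)] that(2) by blast
  have "continuous_on {0..1} h'"
  proof (rule continuous_on_unit_partition[OF f.part])
    fix i assume i: "i \<in> {1..N}"
    let ?I = "{x (i - 1)..x i}" and ?J = "{y (i - 1)..y i}"
    let ?b = "inv_into ?J g"
    have inj: "inj_on g ?J" using g.inj_on_piece[OF i] .
    have "continuous_on (g ` ?J) ?b"
    proof (rule continuous_on_inv)
      show "continuous_on ?J g"
        using continuous_on_subset[OF g.cont unit_partition_piece_subset[OF g.part i]] .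
    qed (use inj in auto)
    moreover have "continuous_on ?I (\<lambda>z. h (f z))"
    proof (rule continuous_on_compose2[where t = "{0..1}" and g = h and f = f])
      show "continuous_on {0..1} h" using h by (simp add: adapted_def)
      show "continuous_on ?I f"
        using continuous_on_subset[OF f.cont unit_partition_piece_subset[OF f.part i]] .
      show "f ` ?I \<subseteq> {0..1}" using f.maps_unit sub[OF i] by blast
    qed
    moreover have "(\<lambda>z. h (f z)) ` ?I \<subseteq> g ` ?J" using ex[OF i] by force
    ultimately have "continuous_on ?I (\<lambda>z. ?b (h (f z)))"
      by (rule continuous_on_compose2[where g = ?b])
    moreover have "?b (h (f z)) = h' z" if "z \<in> ?I" for z
      unfolding h'(3)[OF i that, symmetric] by (rule inv_into_f_f[OF inj h'(2)[OF i that]])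
    ultimately show "continuous_on ?I h'" by (rule continuous_on_eq)
  qed
  then have "adapted N x y h'" using h'(1,2) by (simp add: adapted_def image_subset_iff)
  moreover have "g (h' z) = h (f z)" if "z \<in> {0..1}" for z
    using unit_partition_cover[OF f.part that] h'(3) by metis
  ultimately show ?thesis by blast
qed

text \<open>Distances are measured on each piece in units of its weight. The values of
  \<open>h1\<close> and \<open>h2\<close> at \<open>f z\<close> lie in one piece \<open>j\<close>,
  so \<open>g.contract\<close> compares their preimages; the factor \<open>ug j\<close> cancels and
  \<kappa>g remains.\<close>

lemma pull_back_contract:
  assumes "h1' ` {x (i - 1)..x i} \<subseteq> {y (i - 1)..y i}" "h2' ` {x (i - 1)..x i} \<subseteq> {y (i - 1)..y i}"
    and "\<And>j. j \<in> {1..N} \<Longrightarrow> h1 ` {x (j - 1)..x j} \<subseteq> {y (j - 1)..y j}"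
    and "\<And>j. j \<in> {1..N} \<Longrightarrow> h2 ` {x (j - 1)..x j} \<subseteq> {y (j - 1)..y j}"
    and "\<And>z. z \<in> {0..1} \<Longrightarrow> g (h1' z) = h1 (f z)" "\<And>z. z \<in> {0..1} \<Longrightarrow> g (h2' z) = h2 (f z)"
    and C: "\<And>j z. j \<in> {1..N} \<Longrightarrow> z \<in> {x (j - 1)..x j} \<Longrightarrow> \<bar>h1 z - h2 z\<bar> \<le> C * ug j"
    and i: "i \<in> {1..N}" and z: "z \<in> {x (i - 1)..x i}"
  shows "\<bar>h1' z - h2' z\<bar> \<le> \<kappa>g * C * ug i"
proof -
  have z01: "z \<in> {0..1}" using unit_partition_piece_subset[OF f.part i] z by blast
  obtain j where j: "j \<in> {1..N}" "transition_matrix \<sigma> i j = 1" "f z \<in> {x (j - 1)..x j}"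
    using f.image_in_piece[OF i z] by blast
  have "\<bar>h1' z - h2' z\<bar> * ug j \<le> \<kappa>g * ug i * \<bar>g (h1' z) - g (h2' z)\<bar>"
  proof (rule g.contract[OF i j(1,2)])
    show "h1' z \<in> {y (i - 1)..y i}" "h2' z \<in> {y (i - 1)..y i}" using assms(1,2) z by blast+
    show "g (h1' z) \<in> {y (j - 1)..y j}" "g (h2' z) \<in> {y (j - 1)..y j}"
      unfolding assms(5)[OF z01] assms(6)[OF z01] using assms(3,4)[OF j(1)] j(3) by blast+
  qed
  also have "\<dots> \<le> \<kappa>g * ug i * (C * ug j)"
    unfolding assms(5)[OF z01] assms(6)[OF z01]
    using C[OF j(1,3)] g.rate g.u_pos[OF i] by (intro mult_left_mono) auto
  finally have "\<bar>h1' z - h2' z\<bar> * ug j \<le> (\<kappa>g * C * ug i) * ug j" by (simp add: mult_ac)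
  then show ?thesis using g.u_pos[OF j(1)] by (simp add: mult_le_cancel_right)
qed

text \<open>It turns the trivial bound 1 on distances in the unit interval into the weighted bound
  that starts the iteration.\<close>

lemma weight_bound: "\<exists>C\<ge>0. \<forall>i\<in>{1..N}. 1 \<le> C * ug i"
proof (intro exI[of _ "\<Sum>i=1..N. inverse (ug i)"] conjI ballI)
  have pos: "0 \<le> inverse (ug i)" if "i \<in> {1..N}" for i using g.u_pos[OF that] by simp
  show "0 \<le> (\<Sum>i=1..N. inverse (ug i))" by (rule sum_nonneg) (use pos in auto)
  fix i assume i: "i \<in> {1..N}"
  have "inverse (ug i) \<le> (\<Sum>i=1..N. inverse (ug i))"
    by (rule member_le_sum) (use i pos in auto)
  then have "inverse (ug i) * ug i \<le> (\<Sum>i=1..N. inverse (ug i)) * ug i"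
    by (rule mult_right_mono) (use g.u_pos[OF i] in simp)
  then show "1 \<le> (\<Sum>i=1..N. inverse (ug i)) * ug i" using g.u_pos[OF i] by simp
qed

lemma values_close:
  assumes "h1 ` {x (i - 1)..x i} \<subseteq> {y (i - 1)..y i}" "h2 ` {x (i - 1)..x i} \<subseteq> {y (i - 1)..y i}"
    and i: "i \<in> {1..N}" and "z \<in> {x (i - 1)..x i}"
  shows "\<bar>h1 z - h2 z\<bar> \<le> 1"
proof -
  have "h1 z \<in> {0..1}" "h2 z \<in> {0..1}"
    using assms unit_partition_piece_subset[OF g.part i] by blast+
  then show ?thesis by auto
qed

text \<open>A semiconjugacy is its own pull-back, so every bound on the distance of two of them
  improves by the factor \<kappa>g, again and again.\<close>

lemma semiconjugacy_unique:
  assumes h1: "\<And>i. i \<in> {1..N} \<Longrightarrow> h1 ` {x (i - 1)..x i} \<subseteq> {y (i - 1)..y i}"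
    "\<And>z. z \<in> {0..1} \<Longrightarrow> g (h1 z) = h1 (f z)"
    and h2: "\<And>i. i \<in> {1..N} \<Longrightarrow> h2 ` {x (i - 1)..x i} \<subseteq> {y (i - 1)..y i}"
    "\<And>z. z \<in> {0..1} \<Longrightarrow> g (h2 z) = h2 (f z)"
    and z: "z \<in> {0..1}"
  shows "h1 z = h2 z"
proof -
  obtain C where C: "0 \<le> C" "\<And>i. i \<in> {1..N} \<Longrightarrow> 1 \<le> C * ug i" using weight_bound by blast
  have bound: "\<bar>h1 z - h2 z\<bar> \<le> (\<kappa>g ^ n * C) * ug i" if "i \<in> {1..N}" "z \<in> {x (i - 1)..x i}" for n i z
    using that
  proof (induction n arbitrary: i z)
    case 0
    then show ?case using values_close[OF h1(1)[OF 0(1)] h2(1)[OF 0(1)] 0] C(2)[OF 0(1)] by simp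
  next
    case (Suc n)
    show ?case
      using pull_back_contract[OF h1(1)[OF Suc.prems(1)] h2(1)[OF Suc.prems(1)] h1(1) h2(1) h1(2) h2(2)
          Suc.IH Suc.prems] by (simp add: mult.assoc)
  qed
  obtain i where i: "i \<in> {1..N}" "z \<in> {x (i - 1)..x i}" using unit_partition_cover[OF f.part z] .
  have "(\<lambda>n. \<kappa>g ^ n * C * ug i) \<longlonglongrightarrow> 0 * C * ug i"
    using g.rate by (intro tendsto_intros LIMSEQ_power_zero) auto
  then have "\<bar>h1 z - h2 z\<bar> \<le> 0"
    by (intro LIMSEQ_le_const[where X = "\<lambda>n. \<kappa>g ^ n * C * ug i"]) (use bound[OF i] in auto)
  then show ?thesis by simp
qed

lemma semiconjugacy_exists:
  "\<exists>h. adapted N x y h \<and> (\<forall>z\<in>{0..1}. g (h z) = h (f z))"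
proof -
  \<comment> \<open>\<open>pull_back\<close> only asserts existence, so the iterates are obtained by
    dependent choice.\<close>
  have "\<exists>H. \<forall>n. adapted N x y (H n) \<and> (\<forall>z\<in>{0..1}. g (H (Suc n) z) = H n (f z))"
    by (rule dependent_nat_choice) (use adapted_exists[OF f.part g.part] pull_back in auto)
  then obtain H where H: "\<And>n. adapted N x y (H n)" "\<And>n z. z \<in> {0..1} \<Longrightarrow> g (H (Suc n) z) = H n (f z)"
    by blast
  have sub: "H n ` {x (i - 1)..x i} \<subseteq> {y (i - 1)..y i}" if "i \<in> {1..N}" for n i
    using H(1)[of n] that by (auto simp: adapted_def)
  obtain C where C: "0 \<le> C" "\<And>i. i \<in> {1..N} \<Longrightarrow> 1 \<le> C * ug i" using weight_bound by blast
  have bound: "\<bar>H (Suc n) z - H n z\<bar> \<le> (\<kappa>g ^ n * C) * ug i" if "i \<in> {1..N}" "z \<in> {x (i - 1)..x i}" for n i z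
    using that
  proof (induction n arbitrary: i z)
    case 0
    then show ?case using values_close[OF sub[OF 0(1)] sub[OF 0(1)] 0, of "Suc 0" 0] C(2)[OF 0(1)] by simp
  next
    case (Suc n)
    show ?case
      using pull_back_contract[OF sub[OF Suc.prems(1)] sub[OF Suc.prems(1)] sub sub H(2) H(2)
          Suc.IH Suc.prems] by (simp add: mult.assoc)
  qed
  \<comment> \<open>A common upper bound for the weights turns the bounds on the pieces into one
    geometric bound on the whole interval, as the Weierstrass test for the telescoping series
    requires.\<close>
  define U where "U = (\<Sum>i=1..N. ug i)"
  have bound': "norm (H (Suc n) z - H n z) \<le> \<kappa>g ^ n * (C * U)" if z: "z \<in> {0..1}" for n z
  proof -
    obtain i where i: "i \<in> {1..N}" "z \<in> {x (i - 1)..x i}" using unit_partition_cover[OF f.part z] .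
    have "ug i \<le> U" unfolding U_def
      by (rule member_le_sum) (use i g.u_pos in \<open>auto intro: less_imp_le\<close>)
    then have "\<kappa>g ^ n * C * ug i \<le> \<kappa>g ^ n * C * U" using g.rate C by (intro mult_left_mono) auto
    then show ?thesis using bound[OF i, of n] by (simp add: mult.assoc)
  qed
  have "uniformly_convergent_on {0..1} (\<lambda>n z. \<Sum>k<n. H (Suc k) z - H k z)"
  proof (rule Weierstrass_m_test')
    show "summable (\<lambda>n. \<kappa>g ^ n * (C * U))" using g.rate by (intro summable_mult2 summable_geometric) auto
  qed (use bound' in auto)
  then obtain D where D: "uniform_limit {0..1} (\<lambda>n z. \<Sum>k<n. H (Suc k) z - H k z) D sequentially"
    by (auto simp: uniformly_convergent_on_def)
  define h where "h z = D z + H 0 z" for z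
  have "uniform_limit {0..1} (\<lambda>n z. (\<Sum>k<n. H (Suc k) z - H k z) + H 0 z) h sequentially"
    unfolding h_def by (intro uniform_limit_intros D)
  moreover have "(\<Sum>k<n. H (Suc k) z - H k z) + H 0 z = H n z" for n z
    using sum_lessThan_telescope[of "\<lambda>n. H n z" n] by simp
  ultimately have lim: "uniform_limit {0..1} H h sequentially" by simp
  have ptw: "(\<lambda>n. H n z) \<longlonglongrightarrow> h z" if "z \<in> {0..1}" for z
    using tendsto_uniform_limitI[OF lim that] .
  have cont: "continuous_on {0..1} h"
    by (rule uniform_limit_theorem[OF _ lim]) (use H(1) in \<open>auto simp: adapted_def\<close>)
  have hk: "h (x k) = y k" if "k \<le> N" for k
  proof -
    have "(\<lambda>n. H n (x k)) \<longlonglongrightarrow> h (x k)" using ptw unit_partition_bounds[OF f.part that] by auto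
    moreover have "H n (x k) = y k" for n using H(1)[of n] that by (auto simp: adapted_def)
    ultimately show ?thesis using LIMSEQ_const_iff[of "y k" "h (x k)"] by auto
  qed
  have hi: "h z \<in> {y (i - 1)..y i}" if i: "i \<in> {1..N}" and z: "z \<in> {x (i - 1)..x i}" for i z
  proof -
    have "z \<in> {0..1}" using unit_partition_piece_subset[OF f.part i] z by blast
    moreover have "H n z \<in> {y (i - 1)..y i}" for n using sub[OF i] z by blast
    ultimately show ?thesis by (intro closed_sequentially[OF _ _ ptw]) auto
  qed
  have h01: "h z \<in> {0..1}" if "z \<in> {0..1}" for z
    by (rule piecewise_maps_unit[OF f.part g.part _ that]) (use hi in blast)
  have "g (h z) = h (f z)" if z: "z \<in> {0..1}" for z
  proof -
    have H01: "H n z \<in> {0..1}" for n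
      by (rule piecewise_maps_unit[OF f.part g.part sub z])
    have "(\<lambda>n. g (H (Suc n) z)) \<longlonglongrightarrow> g (h z)"
      using g.cont h01[OF z] H01 LIMSEQ_Suc[OF ptw[OF z]]
      by (intro continuous_on_tendsto_compose[of "{0..1}" g]) auto
    moreover have "(\<lambda>n. g (H (Suc n) z)) \<longlonglongrightarrow> h (f z)" using H(2)[OF z] ptw[OF f.maps_unit[OF z]] by simp
    ultimately show ?thesis by (rule LIMSEQ_unique)
  qed
  then show ?thesis using cont hk hi by (intro exI[of _ h]) (auto simp: adapted_def)
qed

end

theorem expanding_systems_conjugate:
  assumes f: "expanding_system N \<sigma> x f uf \<kappa>f" and g: "expanding_system N \<sigma> y g ug \<kappa>g"
  shows "topologically_conjugate f g"
proof -
  interpret fg: two_systems N \<sigma> x f uf \<kappa>f y g ug \<kappa>g by (intro two_systems.intro f g)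
  interpret gf: two_systems N \<sigma> y g ug \<kappa>g x f uf \<kappa>f by (intro two_systems.intro f g)
  \<comment> \<open>A system paired with itself: uniqueness here compares \<open>k \<circ> h\<close>
    with the identity, and \<open>h \<circ> k\<close> in the next case.\<close>
  interpret ff: two_systems N \<sigma> x f uf \<kappa>f x f uf \<kappa>f by (intro two_systems.intro f)
  interpret gg: two_systems N \<sigma> y g ug \<kappa>g y g ug \<kappa>g by (intro two_systems.intro g)
  obtain h where h: "adapted N x y h" "\<And>z. z \<in> {0..1} \<Longrightarrow> g (h z) = h (f z)"
    using fg.semiconjugacy_exists by metis
  obtain k where k: "adapted N y x k" "\<And>z. z \<in> {0..1} \<Longrightarrow> f (k z) = k (g z)"
    using gf.semiconjugacy_exists by metis
  have hs: "h ` {x (i - 1)..x i} \<subseteq> {y (i - 1)..y i}" if "i \<in> {1..N}" for i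
    using h(1) that by (auto simp: adapted_def)
  have ks: "k ` {y (i - 1)..y i} \<subseteq> {x (i - 1)..x i}" if "i \<in> {1..N}" for i
    using k(1) that by (auto simp: adapted_def)
  have h01: "h z \<in> {0..1}" if "z \<in> {0..1}" for z
    by (rule piecewise_maps_unit[OF fg.f.part fg.g.part hs that])
  have k01: "k z \<in> {0..1}" if "z \<in> {0..1}" for z
    by (rule piecewise_maps_unit[OF fg.g.part fg.f.part ks that])
  have kh: "(k \<circ> h) z = id z" if "z \<in> {0..1}" for z
  proof (rule ff.semiconjugacy_unique[OF _ _ _ _ that])
    show "(k \<circ> h) ` {x (i - 1)..x i} \<subseteq> {x (i - 1)..x i}" if "i \<in> {1..N}" for i
      using hs[OF that] ks[OF that] by (auto simp: image_subset_iff)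
    show "f ((k \<circ> h) w) = (k \<circ> h) (f w)" if "w \<in> {0..1}" for w
      using k(2)[OF h01[OF that]] h(2)[OF that] by simp
  qed auto
  have hk: "(h \<circ> k) z = id z" if "z \<in> {0..1}" for z
  proof (rule gg.semiconjugacy_unique[OF _ _ _ _ that])
    show "(h \<circ> k) ` {y (i - 1)..y i} \<subseteq> {y (i - 1)..y i}" if "i \<in> {1..N}" for i
      using hs[OF that] ks[OF that] by (auto simp: image_subset_iff)
    show "g ((h \<circ> k) w) = (h \<circ> k) (g w)" if "w \<in> {0..1}" for w
      using h(2)[OF k01[OF that]] k(2)[OF that] by simp
  qed auto
  have "homeomorphism {0..1} {0..1} h k"
    using h(1) k(1) kh hk h01 k01 by (intro homeomorphismI) (auto simp: adapted_def)
  moreover have "g z = h (f (k z))" if "z \<in> {0..1}" for z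
    using hk[OF that] h(2)[OF k01[OF that]] by simp
  ultimately show ?thesis unfolding topologically_conjugate_def by blast
qed

section \<open>Markov maps as expanding systems\<close>

lemma index_map:
  assumes "unit_partition N x" "\<exists>j\<le>N. s (x i) = x j"
  shows "index_map N x s i \<le> N" "s (x i) = x (index_map N x s i)"
proof -
  obtain j where j: "j \<le> N" "s (x i) = x j" using assms(2) by blast
  have "j' = j" if "j' \<le> N \<and> s (x i) = x j'" for j'
    using that j unit_partition_eq_iff[OF assms(1), of j' j] by simp
  then have "index_map N x s i = j" unfolding index_map_def using j by (intro the_equality) auto
  then show "index_map N x s i \<le> N" "s (x i) = x (index_map N x s i)" using j by auto
qed

lemma transition_matrix_le_1: "transition_matrix \<sigma> i j \<le> 1"
  by (simp add: transition_matrix_def)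

text \<open>Equal indices would make row \<open>i\<close> zero, so no arc would enter
  \<open>i\<close>, although some other node must reach it.\<close>

lemma index_map_neq:
  assumes irred: "irreducible_matrix N (transition_matrix \<sigma>)"
    and columns: "\<forall>j\<in>{1..N}. (\<Sum>i=1..N. transition_matrix \<sigma> i j) > 1"
    and i: "i \<in> {1..N}"
  shows "\<sigma> (i - 1) \<noteq> \<sigma> i"
proof
  assume eq: "\<sigma> (i - 1) = \<sigma> i"
  \<comment> \<open>With a single piece the only column sum would be at most 1; so a second node
    exists from which \<open>i\<close> has to be reachable.\<close>
  have "N \<noteq> 1" using columns transition_matrix_le_1[of \<sigma> 1 1] by (intro notI) auto
  then obtain w where w: "w \<in> {1..N}" "w \<noteq> i" using i by (cases "i = 1") (auto intro: that[of 1] that[of N])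
  let ?E = "{(j, i). i \<in> {1..N} \<and> j \<in> {1..N} \<and> transition_matrix \<sigma> i j = 1}"
  have "(w, i) \<in> ?E\<^sup>+" using irred w i by (auto simp: irreducible_matrix_def)
  then obtain k where "(k, i) \<in> ?E" by (meson tranclE)
  then have "transition_matrix \<sigma> i k = 1" by blast
  then show False unfolding transition_matrix_eq_1_iff using eq by auto
qed

text \<open>
  The weights are \<open>(1/\<kappa>) ^ d i\<close>, where \<open>d i\<close> is the distance from \<open>i\<close> to the nearest vertex with at least
  two successors: a vertex with one successor gains by \<open>d\<close>, a branching one because its image
  is longer than each piece that it covers.
\<close>

lemma contracting_weights:
  fixes w :: "nat \<Rightarrow> real"
  assumes irred: "irreducible_matrix N (transition_matrix \<sigma>)"
    and columns: "\<forall>j\<in>{1..N}. (\<Sum>i=1..N. transition_matrix \<sigma> i j) > 1"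
    and N: "0 < N" and w: "\<And>i. i \<in> {1..N} \<Longrightarrow> 0 < w i"
  defines "S \<equiv> \<lambda>i. {j \<in> {1..N}. transition_matrix \<sigma> i j = 1}"
  shows "\<exists>q \<kappa>. 0 < \<kappa> \<and> \<kappa> < 1 \<and> (\<forall>i. 0 < q i) \<and>
    (\<forall>i\<in>{1..N}. \<forall>j\<in>S i. w j * q j \<le> \<kappa> * sum w (S i) * q i)"
proof -
  \<comment> \<open>Arcs point from a covered piece to the covering one, against the dynamics: a
    path from \<open>b\<close> to \<open>i\<close> is an itinerary from \<open>i\<close> to
    \<open>b\<close> read backwards.\<close>
  define E where "E = {(j, i). i \<in> {1..N} \<and> j \<in> {1..N} \<and> transition_matrix \<sigma> i j = 1}"
  define B where "B = {i\<in>{1..N}. \<exists>j\<in>S i. \<exists>k\<in>S i. j \<noteq> k}"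
  have fin: "finite (S i)" for i unfolding S_def by simp
  have SE: "j \<in> S i \<longleftrightarrow> (j, i) \<in> E" if "i \<in> {1..N}" for i j using that by (auto simp: S_def E_def)
  have Spos: "0 < w j" if "j \<in> S i" for i j using that w by (simp add: S_def)
  \<comment> \<open>Double counting: the column sums give at least \<open>2 * N\<close> ones,
    whereas rows with at most one 1 each would give at most \<open>N\<close>.\<close>
  have "B \<noteq> {}"
  proof
    assume "B = {}"
    then have "\<forall>j\<in>S i. \<forall>k\<in>S i. j = k" if "i \<in> {1..N}" for i using that by (auto simp: B_def)
    then have card: "card (S i) \<le> 1" if "i \<in> {1..N}" for i using that card_le_Suc0_iff_eq[OF fin] by simp
    have row: "(\<Sum>j=1..N. transition_matrix \<sigma> i j) = card (S i)" for i
    proof -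
      have "(\<Sum>j=1..N. transition_matrix \<sigma> i j) = (\<Sum>j=1..N. if transition_matrix \<sigma> i j = 1 then 1 else 0)"
        by (intro sum.cong refl) (simp add: transition_matrix_def)
      also have "\<dots> = card (S i)" by (simp add: S_def sum.If_cases Int_def)
      finally show ?thesis .
    qed
    have "2 * N = (\<Sum>j=1..N. 2)" by simp
    also have "\<dots> \<le> (\<Sum>j=1..N. \<Sum>i=1..N. transition_matrix \<sigma> i j)"
      by (intro sum_mono) (use columns in fastforce)
    also have "\<dots> = (\<Sum>i=1..N. \<Sum>j=1..N. transition_matrix \<sigma> i j)" by (rule sum.swap)
    also have "\<dots> \<le> (\<Sum>i=1..N. 1)" unfolding row by (intro sum_mono card)
    finally show False using N by simp
  qed
  then obtain b where b: "b \<in> B" by blast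
  have reach: "\<exists>n. \<exists>b\<in>B. (b, i) \<in> E ^^ n" if i: "i \<in> {1..N}" for i
  proof (cases "i = b")
    case True
    then show ?thesis using b by (intro exI[of _ 0]) auto
  next
    case False
    then have "(b, i) \<in> E\<^sup>+" using irred i b by (auto simp: irreducible_matrix_def E_def B_def)
    then show ?thesis using b by (meson trancl_power)
  qed
  define d where "d i = (LEAST n. \<exists>b\<in>B. (b, i) \<in> E ^^ n)" for i
  have d0: "d i = 0" if "i \<in> B" for i
    unfolding d_def by (rule Least_eq_0) (use that in auto)
  \<comment> \<open>A shortest path ending in \<open>i\<close> must come through the only successor
    \<open>j\<close>; dropping its last arc gives a shorter path to \<open>j\<close>.\<close>
  have dstep: "d j < d i" if i: "i \<in> {1..N}" "i \<notin> B" and j: "j \<in> S i" for i j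
  proof -
    obtain c where c: "c \<in> B" "(c, i) \<in> E ^^ d i"
      using LeastI_ex[OF reach[OF i(1)]] unfolding d_def by blast
    then have "d i \<noteq> 0" using i(2) by (intro notI) auto
    then obtain m where m: "d i = Suc m" by (cases "d i") auto
    then obtain k where k: "(c, k) \<in> E ^^ m" "(k, i) \<in> E" using c(2) by auto
    have "k = j" using i j k(2) SE[OF i(1)] by (auto simp: B_def)
    then have "d j \<le> m" unfolding d_def using k(1) c(1) by (intro Least_le) auto
    then show ?thesis using m by simp
  qed
  define D where "D = (\<Sum>i=1..N. d i)"
  have D: "d i \<le> D" if "i \<in> {1..N}" for i unfolding D_def by (rule member_le_sum) (use that in auto)
  have le_sum: "w j \<le> sum w (S i)" if "j \<in> S i" for i j
    by (rule member_le_sum) (use that fin Spos in \<open>auto intro: less_imp_le\<close>)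
  have less_sum: "w j < sum w (S i)" if i: "i \<in> B" and j: "j \<in> S i" for i j
  proof -
    obtain k where k: "k \<in> S i" "k \<noteq> j" using i unfolding B_def by blast
    have "w j + w k = sum w {j, k}" using k by simp
    also have "\<dots> \<le> sum w (S i)"
      by (rule sum_mono2) (use j k fin Spos in \<open>auto intro: less_imp_le\<close>)
    finally show ?thesis using Spos[OF k(1)] by simp
  qed
  \<comment> \<open>The finitely many shares that one covered piece has in a branching image. The
    extra 1/2 keeps the set nonempty and its maximum positive.\<close>
  define R where "R = insert (1/2) ((\<lambda>(i, j). w j / sum w (S i)) ` (SIGMA i:B. S i))"
  define \<rho> where "\<rho> = Max R"
  have finR: "finite R" unfolding R_def B_def by (auto intro!: finite_SigmaI fin)
  have "\<forall>r\<in>R. r < 1"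
    using less_sum Spos by (fastforce simp: R_def divide_less_eq_1 dest: less_trans)
  then have \<rho>1: "\<rho> < 1" unfolding \<rho>_def using finR by (subst Max_less_iff) (auto simp: R_def)
  have \<rho>0: "0 < \<rho>" unfolding \<rho>_def using finR Max_ge[OF finR, of "1/2"] by (auto simp: R_def)
  have \<rho>: "w j \<le> \<rho> * sum w (S i)" if i: "i \<in> B" and j: "j \<in> S i" for i j
  proof -
    have "w j / sum w (S i) \<le> \<rho>" unfolding \<rho>_def using finR i j by (intro Max_ge) (auto simp: R_def)
    moreover have "0 < sum w (S i)" using less_sum[OF i j] Spos[OF j] by linarith
    ultimately show ?thesis by (simp add: pos_divide_le_eq)
  qed
  \<comment> \<open>One branching gain \<rho> has to pay for its own step and for at most
    \<open>D\<close> further ones, hence the root of order \<open>D + 1\<close>.\<close>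
  define \<kappa> where "\<kappa> = root (Suc D) \<rho>"
  have \<kappa>: "0 < \<kappa>" "\<kappa> < 1" "\<kappa> ^ Suc D = \<rho>"
    unfolding \<kappa>_def using \<rho>0 \<rho>1 by (auto simp del: power_Suc simp: real_root_pow_pos)
  define q where "q i = inverse \<kappa> ^ d i" for i
  have qpos: "0 < q i" for i unfolding q_def using \<kappa> by simp
  have "w j * q j \<le> \<kappa> * sum w (S i) * q i" if i: "i \<in> {1..N}" and j: "j \<in> S i" for i j
  proof (cases "i \<in> B")
    case True
    have jN: "j \<in> {1..N}" using j by (simp add: S_def)
    have W: "0 < sum w (S i)" using less_sum[OF True j] Spos[OF j] by linarith
    \<comment> \<open>Here \<open>q i = 1\<close>. Of the \<open>D + 1\<close> factors \<kappa> in
      \<rho>, one is the required rate and \<open>d j\<close> of them cancel \<open>q j\<close>; the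
      remaining ones are at most 1.\<close>
    have "w j * q j \<le> (\<rho> * sum w (S i)) * q j" using \<rho>[OF True j] qpos[of j] by (intro mult_right_mono) auto
    also have "\<rho> * q j = \<kappa> * \<kappa> ^ (D - d j)"
    proof -
      have "\<rho> = \<kappa> * \<kappa> ^ (D - d j) * \<kappa> ^ d j"
        using \<kappa>(3) D[OF jN] by (simp add: power_add[symmetric] mult.assoc)
      then show ?thesis unfolding q_def using \<kappa>(1) by (simp add: power_inverse)
    qed
    then have "(\<rho> * sum w (S i)) * q j = \<kappa> * sum w (S i) * \<kappa> ^ (D - d j)" by (simp add: mult_ac)
    also have "\<dots> \<le> \<kappa> * sum w (S i) * 1"
      using \<kappa> W by (intro mult_left_mono power_le_one) auto
    finally show ?thesis using d0[OF True] by (simp add: q_def)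
  next
    case False
    have q: "q j \<le> \<kappa> * q i"
    proof -
      obtain m where m: "d i = Suc m" "d j \<le> m" using dstep[OF i False j] by (cases "d i") auto
      have "\<kappa> * q i = inverse \<kappa> ^ m" unfolding q_def m(1) using \<kappa>(1) by simp
      moreover have "inverse \<kappa> ^ d j \<le> inverse \<kappa> ^ m"
        using \<kappa>(1,2) m(2) by (intro power_increasing) (auto simp: one_le_inverse_iff)
      ultimately show ?thesis by (simp add: q_def)
    qed
    have "w j * q j \<le> sum w (S i) * (\<kappa> * q i)"
      using le_sum[OF j] q Spos[OF j] qpos[of j] by (intro mult_mono) auto
    then show ?thesis by (simp add: mult_ac)
  qed
  then show ?thesis using \<kappa> qpos by blast
qed

text \<open>An affine branch stretches by the ratio of \<open>sum w (S i)\<close>, the length of its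
  image, to \<open>w i\<close>. With weights \<open>w i * q i\<close> the denominator cancels, and
  the required contraction is the inequality of \<open>contracting_weights\<close>.\<close>

lemma linear_expanding_system:
  assumes part: "unit_partition N x" and cont: "continuous_on {0..1} s"
    and le: "\<And>i. i \<le> N \<Longrightarrow> \<sigma> i \<le> N" and pt: "\<And>i. i \<le> N \<Longrightarrow> s (x i) = x (\<sigma> i)"
    and mono: "\<And>i. i \<in> {1..N} \<Longrightarrow> monotone_fn_on {x (i - 1)..x i} s"
    and affine: "\<And>i. i \<in> {1..N} \<Longrightarrow> affine_fn_on {x (i - 1)..x i} s"
    and irred: "irreducible_matrix N (transition_matrix \<sigma>)"
    and columns: "\<forall>j\<in>{1..N}. (\<Sum>i=1..N. transition_matrix \<sigma> i j) > 1"
  shows "\<exists>u \<kappa>. expanding_system N \<sigma> x s u \<kappa>"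
proof -
  define S where "S i = {j \<in> {1..N}. transition_matrix \<sigma> i j = 1}" for i
  define w where "w i = x i - x (i - 1)" for i
  have w: "0 < w i" if "i \<in> {1..N}" for i unfolding w_def using unit_partition_step[OF part that] by simp
  obtain q \<kappa> where q: "0 < \<kappa>" "\<kappa> < 1" "\<And>i. 0 < q i"
    "\<And>i j. i \<in> {1..N} \<Longrightarrow> j \<in> S i \<Longrightarrow> w j * q j \<le> \<kappa> * sum w (S i) * q i"
    using contracting_weights[OF irred columns unit_partition_pos[OF part], of w, OF w]
    unfolding S_def by blast
  have slope: "sum w (S i) * \<bar>y - z\<bar> = w i * \<bar>s y - s z\<bar>"
    if i: "i \<in> {1..N}" and yz: "y \<in> {x (i - 1)..x i}" "z \<in> {x (i - 1)..x i}" for i y z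
  proof -
    obtain m c where mc: "\<And>z. z \<in> {x (i - 1)..x i} \<Longrightarrow> s z = m * z + c"
      using affine[OF i] unfolding affine_fn_on_def affine_with_slope_on_def by blast
    have N: "\<sigma> (i - 1) \<le> N" "\<sigma> i \<le> N" using le[of i] le[of "i - 1"] i by auto
    have "S i = {min (\<sigma> (i - 1)) (\<sigma> i) + 1..max (\<sigma> (i - 1)) (\<sigma> i)}"
      using N unfolding S_def transition_matrix_eq_1_iff by auto
    then have "sum w (S i) = x (max (\<sigma> (i - 1)) (\<sigma> i)) - x (min (\<sigma> (i - 1)) (\<sigma> i))"
      unfolding w_def using sum_partition_telescope by simp
    also have "\<dots> = \<bar>x (\<sigma> i) - x (\<sigma> (i - 1))\<bar>"
      using unit_partition_le_iff[OF part N] unit_partition_le_iff[OF part N(2,1)]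
      by (auto simp: min_def max_def)
    also have "\<dots> = \<bar>s (x i) - s (x (i - 1))\<bar>" using pt[of i] pt[of "i - 1"] i by auto
    also have "\<dots> = \<bar>m\<bar> * w i" using mc[of "x i"] mc[of "x (i - 1)"] w[OF i]
      by (simp add: w_def abs_mult right_diff_distrib[symmetric])
    finally show ?thesis using mc[OF yz(1)] mc[OF yz(2)]
      by (simp add: abs_mult right_diff_distrib[symmetric])
  qed
  have "expanding_system N \<sigma> x s (\<lambda>i. w i * q i) \<kappa>"
  proof
    show "0 < w i * q i" if "i \<in> {1..N}" for i using w[OF that] q(3) by simp
    show "\<bar>y - z\<bar> * (w j * q j) \<le> \<kappa> * (w i * q i) * \<bar>s y - s z\<bar>"
      if "i \<in> {1..N}" "j \<in> {1..N}" "transition_matrix \<sigma> i j = 1"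
        "y \<in> {x (i - 1)..x i}" "z \<in> {x (i - 1)..x i}" for i j y z
    proof -
      have "j \<in> S i" using that by (simp add: S_def)
      then have "\<bar>y - z\<bar> * (w j * q j) \<le> \<bar>y - z\<bar> * (\<kappa> * sum w (S i) * q i)"
        using q(4)[OF that(1)] by (intro mult_left_mono) auto
      also have "\<dots> = \<kappa> * q i * (sum w (S i) * \<bar>y - z\<bar>)" by (simp add: mult_ac)
      also have "\<dots> = \<kappa> * (w i * q i) * \<bar>s y - s z\<bar>" unfolding slope[OF that(1,4,5)] by (simp add: mult_ac)
      finally show ?thesis .
    qed
    show "\<sigma> (i - 1) \<noteq> \<sigma> i" if "i \<in> {1..N}" for i by (rule index_map_neq[OF irred columns that])
  qed (use part cont le pt mono q in auto)
  then show ?thesis by blast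
qed

text \<open>The partition \<open>p\<close> that witnesses expansion need not be \<open>x\<close>.
  Across points of \<open>p\<close> inside a piece of \<open>x\<close> the estimates are chained; no
  reweighting is necessary.\<close>

lemma expanding_markov_expanding_system:
  assumes part: "unit_partition N x" and s: "expanding_markov s"
    and le: "\<And>i. i \<le> N \<Longrightarrow> \<sigma> i \<le> N" and pt: "\<And>i. i \<le> N \<Longrightarrow> s (x i) = x (\<sigma> i)"
    and mono: "\<And>i. i \<in> {1..N} \<Longrightarrow> monotone_fn_on {x (i - 1)..x i} s"
    and neq: "\<And>i. i \<in> {1..N} \<Longrightarrow> \<sigma> (i - 1) \<noteq> \<sigma> i"
  shows "\<exists>u \<kappa>. expanding_system N \<sigma> x s u \<kappa>"
proof -
  obtain n p c where p: "unit_partition n p" and c: "1 < c"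
    and ex: "\<And>i y z. i \<in> {1..n} \<Longrightarrow> y \<in> {p (i - 1)..p i} \<Longrightarrow> z \<in> {p (i - 1)..p i} \<Longrightarrow>
      c * \<bar>y - z\<bar> \<le> \<bar>s y - s z\<bar>"
    using s unfolding expanding_markov_def by blast
  have step: "c * \<bar>y - z\<bar> \<le> \<bar>s y - s z\<bar>"
    if i: "i \<in> {1..N}" and y: "y \<in> {x (i - 1)..x i}" and z: "z \<in> {x (i - 1)..x i}" and "y < z" for i y z
  proof -
    have sub: "{x (i - 1)..x i} \<subseteq> {0..1}" by (rule unit_partition_piece_subset[OF part i])
    show ?thesis
    proof (rule chain_interval[where F = "p ` {..n}" and a = y and b = z
          and R = "\<lambda>y z. c * \<bar>y - z\<bar> \<le> \<bar>s y - s z\<bar>"])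
      show "y < z" by fact
    next
      fix y' z' assume yz: "y \<le> y'" "y' < z'" "z' \<le> z" "p ` {..n} \<inter> {y'<..<z'} = {}"
      have 01: "p 0 \<le> y'" "y' < p n" using p sub y z yz by (auto simp: unit_partition_def)
      obtain k where k: "0 < k" "k \<le> n" "p (k - 1) \<le> y'" "y' < p k"
        using partition_cover_half_open[OF unit_partition_pos[OF p] 01] by blast
      have "p k \<notin> {y'<..<z'}" using yz(4) k(2) by blast
      then have "z' \<le> p k" using k(4) by simp
      then show "c * \<bar>y' - z'\<bar> \<le> \<bar>s y' - s z'\<bar>" using ex[of k y' z'] k yz by auto
    next
      fix y' m z' assume yz: "y \<le> y'" "y' < m" "m < z'" "z' \<le> z"
        and a: "c * \<bar>y' - m\<bar> \<le> \<bar>s y' - s m\<bar>" "c * \<bar>m - z'\<bar> \<le> \<bar>s m - s z'\<bar>"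
      have I: "y' \<in> {x (i - 1)..x i}" "m \<in> {x (i - 1)..x i}" "z' \<in> {x (i - 1)..x i}"
        using y z yz by auto
      \<comment> \<open>Without monotonicity the two displacements could cancel.\<close>
      have "\<bar>s y' - s z'\<bar> = \<bar>s y' - s m\<bar> + \<bar>s m - s z'\<bar>"
        using mono[OF i] unfolding monotone_fn_on_def
      proof
        assume m: "mono_on {x (i - 1)..x i} s"
        show ?thesis using monotone_onD[OF m I(1,2)] monotone_onD[OF m I(2,3)] yz by auto
      next
        assume m: "antimono_on {x (i - 1)..x i} s"
        show ?thesis using monotone_onD[OF m I(1,2)] monotone_onD[OF m I(2,3)] yz by auto
      qed
      moreover have "c * \<bar>y' - z'\<bar> = c * \<bar>y' - m\<bar> + c * \<bar>m - z'\<bar>" using yz by (simp add: algebra_simps)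
      ultimately show "c * \<bar>y' - z'\<bar> \<le> \<bar>s y' - s z'\<bar>" using a by linarith
    qed simp
  qed
  have all: "c * \<bar>y - z\<bar> \<le> \<bar>s y - s z\<bar>"
    if i: "i \<in> {1..N}" and y: "y \<in> {x (i - 1)..x i}" and z: "z \<in> {x (i - 1)..x i}" for i y z
    using step[OF i y z] step[OF i z y] by (cases y z rule: linorder_cases) (auto simp: abs_minus_commute)
  have "expanding_system N \<sigma> x s (\<lambda>_. 1) (inverse c)"
  proof
    show "\<bar>y - z\<bar> * 1 \<le> inverse c * 1 * \<bar>s y - s z\<bar>"
      if "i \<in> {1..N}" "y \<in> {x (i - 1)..x i}" "z \<in> {x (i - 1)..x i}" for i y z
      using all[OF that] c by (simp add: field_simps)
    show "continuous_on {0..1} s" using s by (simp add: expanding_markov_def interval_map_def)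
    show "inverse c < 1" using c by (simp add: inverse_less_1_iff)
  qed (use part le pt mono neq c in auto)
  then show ?thesis by blast
qed

section \<open>Construction of the associated map\<close>

text \<open>The Perron-Frobenius argument: a nonnegative fixed vector with a zero entry vanishes at
  every node from which that entry can be reached, hence everywhere. Applied to
  \<open>v - r w\<close>, it leaves proportional vectors, and the normalisation does the
  rest.\<close>

lemma irreducible_fixed_vector_unique:
  fixes A :: "nat \<Rightarrow> nat \<Rightarrow> real" and v w :: "nat \<Rightarrow> real"
  assumes irred: "irreducible_matrix N B" and N: "0 < N"
    and A: "\<And>i j. i \<in> {1..N} \<Longrightarrow> j \<in> {1..N} \<Longrightarrow> 0 \<le> A i j"
    and AB: "\<And>i j. i \<in> {1..N} \<Longrightarrow> j \<in> {1..N} \<Longrightarrow> B i j = 1 \<Longrightarrow> 0 < A i j"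
    and v: "\<And>i. i \<in> {1..N} \<Longrightarrow> v i = (\<Sum>j=1..N. A i j * v j)"
      "(\<Sum>i=1..N. v i) = 1"
    and w: "\<And>i. i \<in> {1..N} \<Longrightarrow> w i = (\<Sum>j=1..N. A i j * w j)"
      "(\<Sum>i=1..N. w i) = 1" "\<And>i. i \<in> {1..N} \<Longrightarrow> 0 < w i"
    and i: "i \<in> {1..N}"
  shows "v i = w i"
proof -
  \<comment> \<open>The largest multiple of \<open>w\<close> that stays below \<open>v\<close>;
    where the minimum is attained the difference has a zero entry.\<close>
  define r where "r = Min ((\<lambda>i. v i / w i) ` {1..N})"
  define u where "u i = v i - r * w i" for i
  let ?E = "{(j, i). i \<in> {1..N} \<and> j \<in> {1..N} \<and> B i j = 1}"
  have ne: "(\<lambda>i. v i / w i) ` {1..N} \<noteq> {}" using N by auto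
  have nonneg: "0 \<le> u i" if "i \<in> {1..N}" for i
  proof -
    have "r \<le> v i / w i" unfolding r_def using that by (intro Min_le) auto
    then show ?thesis using w(3)[OF that] by (simp add: u_def pos_le_divide_eq)
  qed
  have "r \<in> (\<lambda>i. v i / w i) ` {1..N}" unfolding r_def using ne by (intro Min_in) auto
  then obtain k where k: "k \<in> {1..N}" "r = v k / w k" by blast
  have uk: "u k = 0" using w(3)[OF k(1)] by (simp add: u_def k(2))
  have fixpt: "u i = (\<Sum>j=1..N. A i j * u j)" if "i \<in> {1..N}" for i
    using v(1)[OF that] w(1)[OF that]
    by (simp add: u_def algebra_simps sum_subtractf sum_distrib_left)
  have pred: "u j = 0" if "(j, i) \<in> ?E" "u i = 0" for i j
  proof -
    have ij: "i \<in> {1..N}" "j \<in> {1..N}" "B i j = 1" using that(1) by auto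
    have "(\<Sum>j=1..N. A i j * u j) = 0" using fixpt[OF ij(1)] that(2) by simp
    then have "A i j * u j = 0"
      using sum_nonneg_eq_0_iff[of "{1..N}" "\<lambda>j. A i j * u j"] A[OF ij(1)] nonneg ij(2) by auto
    then show ?thesis using AB[OF ij] by simp
  qed
  have zero: "u j = 0" if "j \<in> {1..N}" for j
  proof (cases "j = k")
    case False
    then have "(j, k) \<in> ?E\<^sup>+" using irred that k(1) by (auto simp: irreducible_matrix_def)
    then show ?thesis
    proof (induction rule: converse_trancl_induct)
      case (base j)
      then show ?case using pred uk by blast
    next
      case (step j l)
      then show ?case using pred by blast
    qed
  qed (use uk in simp)
  then have vr: "v j = r * w j" if "j \<in> {1..N}" for j using that by (simp add: u_def)
  have "(\<Sum>i=1..N. v i) = r * (\<Sum>i=1..N. w i)" unfolding sum_distrib_left using vr by (intro sum.cong) auto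
  then show ?thesis using v(2) w(2) vr[OF i] by simp
qed

text \<open>The length equation is deliberately left out: existence assumes it, whereas for
  uniqueness it has to be derived from the map.\<close>

locale slope_family =
  fixes N :: nat and \<sigma> :: "nat \<Rightarrow> nat" and a :: "nat \<Rightarrow> nat \<Rightarrow> real" and x :: "nat \<Rightarrow> real"
  assumes part: "unit_partition N x"
    and index_le: "\<And>i. i \<le> N \<Longrightarrow> \<sigma> i \<le> N"
    and index_neq: "\<And>i. i \<in> {1..N} \<Longrightarrow> \<sigma> (i - 1) \<noteq> \<sigma> i"
    and admissible: "admissible_slopes N \<sigma> a"
begin

abbreviation A where "A \<equiv> slope_matrix \<sigma> a"

definition \<epsilon> :: "nat \<Rightarrow> real" where "\<epsilon> i = (if \<sigma> (i - 1) < \<sigma> i then 1 else - 1)"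

definition lo :: "nat \<Rightarrow> real" where "lo i = x (min (\<sigma> (i - 1)) (\<sigma> i))"

definition hi :: "nat \<Rightarrow> real" where "hi i = x (max (\<sigma> (i - 1)) (\<sigma> i))"

lemma A_pos:
  assumes "i \<in> {1..N}" "j \<in> {1..N}" "transition_matrix \<sigma> i j = 1"
  shows "0 < A i j"
  using assms admissible unfolding admissible_slopes_def slope_matrix_def by auto

lemma A_nonneg: "0 \<le> A i j"
  unfolding slope_matrix_def by simp

lemma A_mult_slope:
  assumes "i \<in> {1..N}" "j \<in> {1..N}" "transition_matrix \<sigma> i j = 1"
  shows "A i j * a i j = \<epsilon> i"
proof -
  have "a i j \<noteq> 0 \<and> (if \<sigma> (i - 1) < \<sigma> i then a i j > 0 else a i j < 0)"
    using admissible assms unfolding admissible_slopes_def by blast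
  then show ?thesis using assms(3)
    by (cases "\<sigma> (i - 1) < \<sigma> i") (auto simp: slope_matrix_def \<epsilon>_def field_simps)
qed

lemma index_bounds:
  assumes "i \<in> {1..N}"
  shows "\<sigma> (i - 1) \<le> N" "\<sigma> i \<le> N"
  using index_le[of i] index_le[of "i - 1"] assms by auto

text \<open>Row \<open>i\<close> vanishes off the pieces between the two image indices, so the whole
  sum is the increment of the inverse branch over its image. This ties the \<open>i\<close>-th entry
  of \<open>A v\<close> to the length that the branch needs.\<close>

lemma pl_image:
  assumes i: "i \<in> {1..N}"
  shows "pl N x (A i) (x (\<sigma> i)) - pl N x (A i) (x (\<sigma> (i - 1)))
    = \<epsilon> i * (\<Sum>j=1..N. A i j * (x j - x (j - 1)))"
proof -
  let ?g = "\<lambda>j. A i j * (x j - x (j - 1))"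
  have part_sum: "(\<Sum>j=1..M. ?g j) - (\<Sum>j=1..m. ?g j) = (\<Sum>j=1..N. ?g j)"
    if "m \<le> M" "M \<le> N" "m = min (\<sigma> (i - 1)) (\<sigma> i)" "M = max (\<sigma> (i - 1)) (\<sigma> i)" for m M
  proof -
    have zero: "?g j = 0" if "\<not> (m < j \<and> j \<le> M)" for j
    proof -
      have "transition_matrix \<sigma> i j \<noteq> 1"
        unfolding transition_matrix_eq_1_iff using that \<open>m = _\<close> \<open>M = _\<close> by simp
      then show ?thesis by (simp add: slope_matrix_def)
    qed
    have "(\<Sum>j=1..m. ?g j) = 0" using zero by (intro sum.neutral) auto
    moreover have "(\<Sum>j=1..M. ?g j) = (\<Sum>j=1..N. ?g j)"
      by (rule sum.mono_neutral_left) (use that zero in auto)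
    ultimately show ?thesis by simp
  qed
  show ?thesis
  proof (cases "\<sigma> (i - 1) < \<sigma> i")
    case True
    then show ?thesis using part_sum[of "\<sigma> (i - 1)" "\<sigma> i"] index_bounds[OF i]
      by (simp add: pl_at[OF part] \<epsilon>_def)
  next
    case False
    then show ?thesis using part_sum[of "\<sigma> i" "\<sigma> (i - 1)"] index_bounds[OF i]
      by (simp add: pl_at[OF part] \<epsilon>_def)
  qed
qed

lemma pl_strict:
  assumes i: "i \<in> {1..N}" and w: "lo i \<le> w" "w < w'" "w' \<le> hi i"
  shows "pl N x (A i) w < pl N x (A i) w'"
proof (rule pl_strict_mono[OF part])
  let ?m = "min (\<sigma> (i - 1)) (\<sigma> i)" and ?M = "max (\<sigma> (i - 1)) (\<sigma> i)"
  show "x ?m \<le> w" "w < w'" "w' \<le> x ?M" using w unfolding lo_def hi_def by auto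
  show "?m \<le> ?M" by auto
  show "?M \<le> N" using index_bounds[OF i] by auto
  show "0 < A i j" if "?m < j" "j \<le> ?M" for j
    by (rule A_pos[OF i]) (use that index_bounds[OF i] in \<open>auto simp: transition_matrix_def\<close>)
qed (rule A_nonneg)

lemma lo_hi:
  assumes i: "i \<in> {1..N}"
  shows "lo i = min (x (\<sigma> (i - 1))) (x (\<sigma> i))" "hi i = max (x (\<sigma> (i - 1))) (x (\<sigma> i))"
  unfolding lo_def hi_def
  using unit_partition_le_iff[OF part index_bounds[OF i]]
    unit_partition_le_iff[OF part index_bounds(2)[OF i] index_bounds(1)[OF i]]
  by (auto simp: min_def max_def)

text \<open>
  The increasing function \<open>\<psi>\<^sub>i = pl N x (A i)\<close> has slope \<open>1/\<bar>a i j\<bar>\<close> on the \<open>j\<close>-th piece, so up to a constant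
  and the sign \<open>\<epsilon> i\<close> it is the inverse of the \<open>i\<close>-th branch of any associated map.
\<close>

definition branch :: "nat \<Rightarrow> real \<Rightarrow> real \<Rightarrow> bool" where
  "branch i z w \<longleftrightarrow> w \<in> {lo i..hi i} \<and>
     pl N x (A i) w - pl N x (A i) (x (\<sigma> (i - 1))) = \<epsilon> i * (z - x (i - 1))"

lemma branch_unique:
  assumes "i \<in> {1..N}" "branch i z w" "branch i z w'"
  shows "w = w'"
  using pl_strict[OF assms(1), of w w'] pl_strict[OF assms(1), of w' w] assms(2,3)
  by (cases w w' rule: linorder_cases) (auto simp: branch_def)

lemma \<epsilon>_cases: "\<epsilon> i = 1 \<or> \<epsilon> i = - 1"
  by (simp add: \<epsilon>_def)

text \<open>By the length equation the inverse branch grows over its image by exactly the length of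
  the piece. So every \<open>z\<close> in the piece receives a value by the intermediate value
  theorem, and the right endpoint receives \<open>x (\<sigma> i)\<close>.\<close>

lemma associated_exists:
  assumes fixpt: "\<And>i. i \<in> {1..N} \<Longrightarrow> x i - x (i - 1) = (\<Sum>j=1..N. A i j * (x j - x (j - 1)))"
  shows "\<exists>t. (\<forall>k\<le>N. t (x k) = x (\<sigma> k)) \<and> (\<forall>i\<in>{1..N}. \<forall>z\<in>{x (i - 1)..x i}. branch i z (t z))"
proof (rule piecewise_choice[OF part])
  fix k i assume k: "k \<le> N" and i: "i \<in> {1..N}" "k = i - 1 \<or> k = i"
  have "pl N x (A i) (x (\<sigma> i)) - pl N x (A i) (x (\<sigma> (i - 1))) = \<epsilon> i * (x i - x (i - 1))"
    using pl_image[OF i(1)] fixpt[OF i(1)] by simp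
  then show "branch i (x k) (x (\<sigma> k))"
    using i(2) unfolding branch_def lo_hi[OF i(1)] by auto
next
  fix i z assume i: "i \<in> {1..N}" and z: "x (i - 1) < z" "z < x i"
  let ?p = "pl N x (A i)"
  have tot: "?p (x (\<sigma> i)) - ?p (x (\<sigma> (i - 1))) = \<epsilon> i * (x i - x (i - 1))"
    using pl_image[OF i] fixpt[OF i] by simp
  let ?c = "?p (x (\<sigma> (i - 1))) + \<epsilon> i * (z - x (i - 1))"
  have "?p (lo i) \<le> ?c \<and> ?c \<le> ?p (hi i)"
  proof (cases "\<sigma> (i - 1) < \<sigma> i")
    case True
    then show ?thesis using tot z by (simp add: lo_def hi_def \<epsilon>_def)
  next
    case False
    then show ?thesis using tot z by (simp add: lo_def hi_def \<epsilon>_def)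
  qed
  moreover have "lo i \<le> hi i" using lo_hi[OF i] by simp
  ultimately have "\<exists>w. lo i \<le> w \<and> w \<le> hi i \<and> ?p w = ?c"
    by (intro IVT' continuous_on_pl) auto
  then show "\<exists>w. branch i z w" unfolding branch_def by auto
qed

lemma branch_continuous:
  assumes i: "i \<in> {1..N}" and t: "\<And>z. z \<in> {x (i - 1)..x i} \<Longrightarrow> branch i z (t z)"
    and tot: "x i - x (i - 1) = (\<Sum>j=1..N. A i j * (x j - x (j - 1)))"
  shows "continuous_on {x (i - 1)..x i} t"
proof -
  let ?p = "pl N x (A i)"
  \<comment> \<open>The equation in \<open>branch\<close> solved for \<open>z\<close>, as \<epsilon>
    is its own inverse. Continuity of \<open>t\<close> follows because it inverts this continuous
    function on a compact interval.\<close>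
  define \<phi> where "\<phi> w = x (i - 1) + \<epsilon> i * (?p w - ?p (x (\<sigma> (i - 1))))" for w
  let ?K = "{lo i..hi i}"
  have e: "\<epsilon> i * \<epsilon> i = 1" using \<epsilon>_cases[of i] by auto
  have tot: "?p (x (\<sigma> i)) - ?p (x (\<sigma> (i - 1))) = \<epsilon> i * (x i - x (i - 1))"
    using pl_image[OF i] tot by simp
  have inI: "\<phi> w \<in> {x (i - 1)..x i}" if w: "w \<in> ?K" for w
  proof -
    have "?p (lo i) \<le> ?p w" "?p w \<le> ?p (hi i)" using w A_nonneg by (auto intro!: pl_mono)
    then show ?thesis using tot unfolding \<phi>_def
      by (cases "\<sigma> (i - 1) < \<sigma> i") (simp_all add: lo_def hi_def \<epsilon>_def)
  qed
  have inv: "t (\<phi> w) = w" if w: "w \<in> ?K" for w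
  proof (rule branch_unique[OF i t[OF inI[OF w]]])
    have "\<epsilon> i * (\<phi> w - x (i - 1)) = ?p w - ?p (x (\<sigma> (i - 1)))"
      using e by (simp add: \<phi>_def mult.assoc[symmetric])
    then show "branch i (\<phi> w) w" unfolding branch_def using w by simp
  qed
  have "continuous_on ?K \<phi>" unfolding \<phi>_def by (intro continuous_intros continuous_on_pl)
  then have "continuous_on (\<phi> ` ?K) t" using inv by (intro continuous_on_inv) auto
  moreover have "{x (i - 1)..x i} \<subseteq> \<phi> ` ?K"
  proof
    fix z assume z: "z \<in> {x (i - 1)..x i}"
    have "\<phi> (t z) = z" "t z \<in> ?K" using t[OF z] e by (simp_all add: branch_def \<phi>_def mult.assoc[symmetric])
    then show "z \<in> \<phi> ` ?K" by (metis imageI)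
  qed
  ultimately show ?thesis by (rule continuous_on_subset)
qed

lemma branch_monotone:
  assumes i: "i \<in> {1..N}" and t: "\<And>z. z \<in> {x (i - 1)..x i} \<Longrightarrow> branch i z (t z)"
  shows "monotone_fn_on {x (i - 1)..x i} t"
proof -
  let ?p = "pl N x (A i)"
  have imp: "t y \<le> t z" if yz: "y \<in> {x (i - 1)..x i}" "z \<in> {x (i - 1)..x i}"
    and "\<epsilon> i * y \<le> \<epsilon> i * z" for y z
  proof (rule ccontr)
    assume "\<not> t y \<le> t z"
    then have "?p (t z) < ?p (t y)"
      using t[OF yz(1)] t[OF yz(2)] by (intro pl_strict[OF i]) (auto simp: branch_def)
    then have "\<epsilon> i * (z - x (i - 1)) < \<epsilon> i * (y - x (i - 1))"
      using t[OF yz(1)] t[OF yz(2)] unfolding branch_def by linarith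
    then show False using that(3) by (simp add: algebra_simps)
  qed
  show ?thesis
  proof (cases "\<epsilon> i = 1")
    case True
    then have "mono_on {x (i - 1)..x i} t" using imp by (intro monotone_onI) auto
    then show ?thesis by (simp add: monotone_fn_on_def)
  next
    case False
    then have "antimono_on {x (i - 1)..x i} t" using imp \<epsilon>_cases[of i] by (intro monotone_onI) auto
    then show ?thesis by (simp add: monotone_fn_on_def)
  qed
qed

lemma branch_affine:
  assumes ij: "i \<in> {1..N}" "j \<in> {1..N}" "transition_matrix \<sigma> i j = 1"
    and t: "\<And>z. z \<in> {x (i - 1)..x i} \<Longrightarrow> branch i z (t z)"
  shows "affine_with_slope_on (a i j) ({x (i - 1)..x i} \<inter> t -` {x (j - 1)..x j}) t"
  unfolding affine_with_slope_on_def
proof (intro exI ballI)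
  let ?p = "pl N x (A i)"
  fix z assume z: "z \<in> {x (i - 1)..x i} \<inter> t -` {x (j - 1)..x j}"
  have "?p (t z) - ?p (x (j - 1)) = A i j * (t z - x (j - 1))"
    by (rule pl_piece[OF part ij(2)]) (use z unit_partition_step[OF part ij(2)] in auto)
  moreover have "?p (t z) - ?p (x (\<sigma> (i - 1))) = \<epsilon> i * (z - x (i - 1))"
    using t z by (auto simp: branch_def)
  ultimately have *: "A i j * (t z - x (j - 1))
      = \<epsilon> i * (z - x (i - 1)) + (?p (x (\<sigma> (i - 1))) - ?p (x (j - 1)))" by linarith
  have "A i j \<noteq> 0" using A_pos[OF ij] by simp
  then have "t z = x (j - 1) + (A i j * (t z - x (j - 1))) / A i j" by simp
  also have "\<dots> = x (j - 1) + (\<epsilon> i / A i j * (z - x (i - 1))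
      + (?p (x (\<sigma> (i - 1))) - ?p (x (j - 1))) / A i j)"
    unfolding * by (simp add: add_divide_distrib)
  also have "\<epsilon> i / A i j = a i j" using A_mult_slope[OF ij] A_pos[OF ij] by (simp add: field_simps)
  finally show "t z = a i j * z + (x (j - 1) - a i j * x (i - 1)
      + (?p (x (\<sigma> (i - 1))) - ?p (x (j - 1))) / A i j)" by (simp add: algebra_simps)
qed

end

section \<open>Piecewise linear structure of associated maps\<close>

lemma finite_set_unit_partition:
  assumes F: "finite F" "F \<subseteq> {0..1}" "0 \<in> F" "1 \<in> F"
  shows "\<exists>n p. unit_partition n p \<and> p ` {..n} = F"
proof -
  define L where "L = sorted_list_of_set F"
  define n where "n = length L - 1"
  have L: "set L = F" "sorted_wrt (<) L" unfolding L_def using F by auto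
  have ne: "L \<noteq> []" using L(1) F by auto
  then have len: "length L = Suc n" unfolding n_def by (cases L) auto
  have less: "L ! i < L ! j" if "i < j" "j \<le> n" for i j
    using sorted_wrt_nth_less[OF L(2)] that len by simp
  have le: "L ! i \<le> L ! j" if "i \<le> j" "j \<le> n" for i j using less[of i j] that by (cases "i = j") auto
  have img: "(!) L ` {..n} = F"
    using L(1) len by (auto simp: set_conv_nth image_iff less_Suc_eq_le)
  have "\<exists>i\<le>n. L ! i = 0" "\<exists>i\<le>n. L ! i = 1" using img F(3,4) by (metis atMost_iff imageE)+
  then obtain i j where ij: "i \<le> n" "L ! i = 0" "j \<le> n" "L ! j = 1" by blast
  have "L ! 0 \<in> F" "L ! n \<in> F" using img by auto
  then have "L ! 0 = 0" "L ! n = 1" using le[of 0 i] le[of j n] ij F(2) by force+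
  then have "unit_partition n ((!) L)" using less by (simp add: unit_partition_def)
  then show ?thesis using img by blast
qed

lemma unit_partition_gap:
  assumes p: "unit_partition n p" and k: "k \<in> {1..n}"
  shows "p ` {..n} \<inter> {p (k - 1)<..<p k} = {}"
proof -
  have "p i \<notin> {p (k - 1)<..<p k}" if i: "i \<le> n" for i
  proof (cases "i \<le> k - 1")
    case True
    have "k - 1 \<le> n" using k by auto
    then show ?thesis using unit_partition_le[OF p True] by auto
  next
    case False
    then have "k \<le> i" by linarith
    then show ?thesis using unit_partition_le[OF p \<open>k \<le> i\<close> i] by auto
  qed
  then show ?thesis by blast
qed

text \<open>It covers both the constructed map and an arbitrary rival, each with its own
  partition.\<close>

locale associated_system = slope_family N \<sigma> a x for N \<sigma> a x +
  fixes t :: "real \<Rightarrow> real"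
  assumes cont: "continuous_on {0..1} t"
    and t_point: "\<And>i. i \<le> N \<Longrightarrow> t (x i) = x (\<sigma> i)"
    and t_mono: "\<And>i. i \<in> {1..N} \<Longrightarrow> monotone_fn_on {x (i - 1)..x i} t"
    and t_affine: "\<And>i j. i \<in> {1..N} \<Longrightarrow> j \<in> {1..N} \<Longrightarrow> transition_matrix \<sigma> i j = 1 \<Longrightarrow>
      affine_with_slope_on (a i j) ({x (i - 1)..x i} \<inter> t -` {x (j - 1)..x j}) t"
begin

lemma image_in_piece:
  assumes "i \<in> {1..N}" "z \<in> {x (i - 1)..x i}"
  obtains j where "j \<in> {1..N}" "transition_matrix \<sigma> i j = 1" "t z \<in> {x (j - 1)..x j}"
  using image_piece[OF part index_le index_neq t_point t_mono assms] by blast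

lemma slope:
  assumes "i \<in> {1..N}" "j \<in> {1..N}" "transition_matrix \<sigma> i j = 1"
    and "y \<in> {x (i - 1)..x i}" "z \<in> {x (i - 1)..x i}" "t y \<in> {x (j - 1)..x j}" "t z \<in> {x (j - 1)..x j}"
  shows "t y - t z = a i j * (y - z)"
proof -
  obtain c where "\<And>z. z \<in> {x (i - 1)..x i} \<inter> t -` {x (j - 1)..x j} \<Longrightarrow> t z = a i j * z + c"
    using t_affine[OF assms(1-3)] unfolding affine_with_slope_on_def by blast
  then have "t y = a i j * y + c" "t z = a i j * z + c" using assms(4-7) by blast+
  then show ?thesis by (simp add: algebra_simps)
qed

lemma slope_nonzero:
  assumes "i \<in> {1..N}" "j \<in> {1..N}" "transition_matrix \<sigma> i j = 1"
  shows "a i j \<noteq> 0"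
  using A_mult_slope[OF assms] \<epsilon>_cases[of i] by auto

text \<open>The slope of \<open>t\<close> can change only where \<open>z\<close> or
  \<open>t z\<close> passes a partition point. One condition suffices, because partition points are
  mapped to partition points; for the same reason the set is forward invariant.\<close>

definition cuts :: "real set" where
  "cuts = {z \<in> {0..1}. t z \<in> x ` {..N}}"

lemma x_cuts: "x ` {..N} \<subseteq> cuts"
  unfolding cuts_def using unit_partition_bounds[OF part] t_point index_le by auto

lemma image_cuts: "z \<in> cuts \<Longrightarrow> t z \<in> cuts"
  using x_cuts unfolding cuts_def by blast

text \<open>A nonzero slope allows at most one preimage of a given \<open>x l\<close> for each pair
  of source and target piece.\<close>

lemma finite_cuts: "finite cuts"
proof -
  define G where "G i j l = {z \<in> {x (i - 1)..x i}. t z \<in> {x (j - 1)..x j} \<and> t z = x l}" for i j l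
  define P where "P = {(i, j). i \<in> {1..N} \<and> j \<in> {1..N} \<and> transition_matrix \<sigma> i j = 1}"
  have "P \<subseteq> {1..N} \<times> {1..N}" unfolding P_def by blast
  then have finP: "finite P" by (rule finite_subset) simp
  have "finite (G i j l)" if "(i, j) \<in> P" for i j l
  proof -
    have ij: "i \<in> {1..N}" "j \<in> {1..N}" "transition_matrix \<sigma> i j = 1" using that by (auto simp: P_def)
    have "y = z" if "y \<in> G i j l" "z \<in> G i j l" for y z
    proof -
      have "t y - t z = a i j * (y - z)" by (rule slope[OF ij]) (use that in \<open>auto simp: G_def\<close>)
      moreover have "t y - t z = 0" using that by (simp add: G_def)
      ultimately show ?thesis using slope_nonzero[OF ij] by simp
    qed
    \<comment> \<open>The inclusion in a singleton also covers an empty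
      \<open>G i j l\<close>.\<close>
    then have "G i j l \<subseteq> {SOME z. z \<in> G i j l}" by (metis singletonI someI subsetI)
    then show ?thesis by (rule finite_subset) simp
  qed
  then have "finite (\<Union>(i, j)\<in>P. \<Union>l\<le>N. G i j l)" using finP by auto
  moreover have "cuts \<subseteq> (\<Union>(i, j)\<in>P. \<Union>l\<le>N. G i j l)"
  proof
    fix z assume "z \<in> cuts"
    then obtain l where l: "z \<in> {0..1}" "l \<le> N" "t z = x l" by (auto simp: cuts_def)
    obtain i where i: "i \<in> {1..N}" "z \<in> {x (i - 1)..x i}" using unit_partition_cover[OF part l(1)] .
    obtain j where j: "j \<in> {1..N}" "transition_matrix \<sigma> i j = 1" "t z \<in> {x (j - 1)..x j}"
      using image_in_piece[OF i] .
    have "(i, j) \<in> P" "z \<in> G i j l" using i j l by (auto simp: P_def G_def)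
    then show "z \<in> (\<Union>(i, j)\<in>P. \<Union>l\<le>N. G i j l)" using l(2) by blast
  qed
  ultimately show ?thesis by (rule rev_finite_subset)
qed

text \<open>The midpoint selects both pieces. Leaving the target piece would force \<open>t\<close>
  through one of its endpoints, which would create a cut inside.\<close>

lemma cut_free_interval:
  assumes yz: "0 \<le> y" "y < z" "z \<le> 1" and free: "cuts \<inter> {y<..<z} = {}"
  obtains i j where "i \<in> {1..N}" "j \<in> {1..N}" "transition_matrix \<sigma> i j = 1"
    "{y..z} \<subseteq> {x (i - 1)..x i}" "t ` {y..z} \<subseteq> {x (j - 1)..x j}"
proof -
  define m where "m = (y + z) / 2"
  have m: "y < m" "m < z" "m \<in> {0..1}" using yz by (auto simp: m_def)
  obtain i where i: "i \<in> {1..N}" "m \<in> {x (i - 1)..x i}" using unit_partition_cover[OF part m(3)] .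
  obtain j where j: "j \<in> {1..N}" "transition_matrix \<sigma> i j = 1" "t m \<in> {x (j - 1)..x j}"
    using image_in_piece[OF i] .
  have no_x: "x k \<notin> {y<..<z}" if "k \<le> N" for k using x_cuts free that by blast
  have iN: "i - 1 \<le> N" "i \<le> N" using i(1) by auto
  have "x (i - 1) \<notin> {y<..<z}" "x i \<notin> {y<..<z}" using no_x[OF iN(1)] no_x[OF iN(2)] by auto
  then have I: "{y..z} \<subseteq> {x (i - 1)..x i}" using i(2) m by auto
  have no_val: "t r \<noteq> x k" if "k \<le> N" "r \<in> {y<..<z}" for k r
  proof
    assume "t r = x k"
    then have "r \<in> cuts" using that yz by (auto simp: cuts_def)
    then show False using that(2) free by blast
  qed
  \<comment> \<open>At the ends \<open>y\<close> and \<open>z\<close> the value may itself be a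
    partition point. Excluding \<open>t q = x k\<close> keeps the crossing point away from
    \<open>q\<close>, hence strictly inside the interval.\<close>
  have avoid: "x k \<notin> closed_segment (t q) (t m)" if q: "q \<in> {y..z}" and k: "k \<le> N" and tq: "t q \<noteq> x k" for q k
  proof
    assume "x k \<in> closed_segment (t q) (t m)"
    moreover have "connected (t ` closed_segment q m)"
    proof (rule connected_continuous_image)
      have "closed_segment q m \<subseteq> {0..1}" using q m yz by (auto simp: closed_segment_eq_real_ivl)
      then show "continuous_on (closed_segment q m) t" by (rule continuous_on_subset[OF cont])
    qed auto
    then have "convex (t ` closed_segment q m)"
      using is_interval_connected_1 is_interval_convex_1 by blast
    then have "closed_segment (t q) (t m) \<subseteq> t ` closed_segment q m"
      by (intro closed_segment_subset) auto
    ultimately obtain r where r: "r \<in> closed_segment q m" "t r = x k" by auto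
    have "r \<noteq> q" using r(2) tq by auto
    then have "r \<in> {y<..<z}" using r(1) q m by (auto simp: closed_segment_eq_real_ivl split: if_splits)
    then show False using no_val[OF k] r(2) by blast
  qed
  have J: "t q \<in> {x (j - 1)..x j}" if q: "q \<in> {y..z}" for q
  proof (rule ccontr)
    assume n: "t q \<notin> {x (j - 1)..x j}"
    have jN: "j - 1 \<le> N" "j \<le> N" using j(1) by auto
    have xj: "x (j - 1) < x j" by (rule unit_partition_step[OF part j(1)])
    have "t q \<noteq> x (j - 1)" "t q \<noteq> x j" using n xj by auto
    from avoid[OF q jN(1) this(1)] avoid[OF q jN(2) this(2)] show False
      using n j(3) by (auto simp: closed_segment_eq_real_ivl split: if_splits)
  qed
  show thesis using that[OF i(1) j(1,2) I] J by blast
qed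

text \<open>On a cut-free interval the slopes of \<open>t\<close> and of the inverse branch multiply
  to \<epsilon>, so the increments match; they are added up from the left end of the piece. Thus the
  equation used for the construction holds for every associated map.\<close>

lemma branch_t:
  assumes i: "i \<in> {1..N}" and z: "z \<in> {x (i - 1)..x i}"
  shows "branch i z (t z)"
proof -
  let ?p = "pl N x (A i)"
  have tp: "t (x (i - 1)) = x (\<sigma> (i - 1))" "t (x i) = x (\<sigma> i)"
    using t_point[of i] t_point[of "i - 1"] i by auto
  have "t z \<in> {lo i..hi i}" using monotone_fn_onD[OF t_mono[OF i], of z] z tp lo_hi[OF i] by auto
  moreover have "?p (t z) - ?p (t (x (i - 1))) = \<epsilon> i * (z - x (i - 1))"
  proof (cases "z = x (i - 1)")
    case False
    then have less: "x (i - 1) < z" using z by auto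
    show ?thesis
    proof (rule chain_interval[where F = cuts and a = "x (i - 1)" and b = z
          and R = "\<lambda>y z. ?p (t z) - ?p (t y) = \<epsilon> i * (z - y)", OF finite_cuts less])
      fix y' z' assume yz: "x (i - 1) \<le> y'" "y' < z'" "z' \<le> z" "cuts \<inter> {y'<..<z'} = {}"
      have in01: "0 \<le> y'" "z' \<le> 1"
        using unit_partition_piece_subset[OF part i] z yz by auto
      obtain k j where k: "k \<in> {1..N}" and j: "j \<in> {1..N}" "transition_matrix \<sigma> k j = 1"
        and sub: "{y'..z'} \<subseteq> {x (k - 1)..x k}" "t ` {y'..z'} \<subseteq> {x (j - 1)..x j}"
        using cut_free_interval[OF in01(1) yz(2) in01(2) yz(4)] .
      have k_le: "x (k - 1) \<le> y'" "z' \<le> x k" using sub(1) yz(2) by auto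
      \<comment> \<open>Distinct pieces have at most an endpoint in common, but both contain a
        nondegenerate interval.\<close>
      have "k = i"
      proof (cases k i rule: linorder_cases)
        case less
        then have "x k \<le> x (i - 1)" using unit_partition_le[OF part, of k "i - 1"] i by auto
        then show ?thesis using k_le yz by auto
      next
        case greater
        then have "x i \<le> x (k - 1)" using unit_partition_le[OF part, of i "k - 1"] k by auto
        then show ?thesis using k_le yz z by auto
      qed
      have tI: "t y' \<in> {x (j - 1)..x j}" "t z' \<in> {x (j - 1)..x j}"
        using sub(2) yz(2) by (auto simp: image_subset_iff)
      have "?p (t z') - ?p (t y') = A i j * (t z' - t y')" by (rule pl_piece[OF part j(1) tI(2,1)])
      also have "t z' - t y' = a i j * (z' - y')"
        using slope[OF k j _ _ tI(2,1)] sub(1) yz(2) \<open>k = i\<close> by auto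
      also have "A i j * (a i j * (z' - y')) = \<epsilon> i * (z' - y')"
        using A_mult_slope[OF k j] \<open>k = i\<close> by (simp add: mult.assoc[symmetric])
      finally show "?p (t z') - ?p (t y') = \<epsilon> i * (z' - y')" .
    next
      fix y' m z'
      assume "?p (t m) - ?p (t y') = \<epsilon> i * (m - y')" "?p (t z') - ?p (t m) = \<epsilon> i * (z' - m)"
      then show "?p (t z') - ?p (t y') = \<epsilon> i * (z' - y')" by (simp add: algebra_simps)
    qed
  qed simp
  ultimately show ?thesis using tp by (simp add: branch_def)
qed

text \<open>This is the branch equation at the right end of the piece, combined with
  \<open>pl_image\<close>.\<close>

lemma lengths_fixpt:
  assumes i: "i \<in> {1..N}"
  shows "x i - x (i - 1) = (\<Sum>j=1..N. A i j * (x j - x (j - 1)))"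
proof -
  have "x i \<in> {x (i - 1)..x i}" using unit_partition_step[OF part i] by simp
  then have "branch i (x i) (t (x i))" by (rule branch_t[OF i])
  then have "\<epsilon> i * (\<Sum>j=1..N. A i j * (x j - x (j - 1))) = \<epsilon> i * (x i - x (i - 1))"
    unfolding pl_image[OF i, symmetric] using t_point[of i] i by (simp add: branch_def)
  then show ?thesis using \<epsilon>_cases[of i] by auto
qed

lemma maps_unit:
  assumes "z \<in> {0..1}"
  shows "t z \<in> {0..1}"
proof -
  obtain i where i: "i \<in> {1..N}" "z \<in> {x (i - 1)..x i}" using unit_partition_cover[OF part assms] .
  obtain j where "j \<in> {1..N}" "t z \<in> {x (j - 1)..x j}" using image_in_piece[OF i] .
  then show ?thesis using unit_partition_piece_subset[OF part] by blast
qed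

text \<open>The slope is recorded as an entry of the family, so that lower bounds and the
  power-of-two form carry over to it.\<close>

definition uniform_slope :: "real set \<Rightarrow> bool" where
  "uniform_slope S \<longleftrightarrow> (\<exists>i\<in>{1..N}. \<exists>j\<in>{1..N}. transition_matrix \<sigma> i j = 1 \<and>
     (\<forall>y\<in>S. \<forall>z\<in>S. t y - t z = a i j * (y - z)))"

lemma cut_free_slope:
  assumes "0 \<le> y" "y < z" "z \<le> 1" "cuts \<inter> {y<..<z} = {}"
  shows "uniform_slope {y..z}"
proof -
  obtain i j where ij: "i \<in> {1..N}" "j \<in> {1..N}" "transition_matrix \<sigma> i j = 1"
    and sub: "{y..z} \<subseteq> {x (i - 1)..x i}" "t ` {y..z} \<subseteq> {x (j - 1)..x j}"
    using cut_free_interval[OF assms] .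
  have "t v - t w = a i j * (v - w)" if "v \<in> {y..z}" "w \<in> {y..z}" for v w
    by (rule slope[OF ij]) (use that sub in blast)+
  then show ?thesis using ij unfolding uniform_slope_def by blast
qed

lemma cut_partition:
  "\<exists>n p. unit_partition n p \<and> p ` {..n} = cuts \<and> (\<forall>k\<in>{1..n}. uniform_slope {p (k - 1)..p k})"
proof -
  have "x 0 \<in> cuts" "x N \<in> cuts" using x_cuts by auto
  then have "0 \<in> cuts" "1 \<in> cuts" using part by (auto simp: unit_partition_def)
  moreover have "cuts \<subseteq> {0..1}" by (auto simp: cuts_def)
  ultimately obtain n p where p: "unit_partition n p" "p ` {..n} = cuts"
    using finite_set_unit_partition[OF finite_cuts] by blast
  have "uniform_slope {p (k - 1)..p k}" if k: "k \<in> {1..n}" for k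
  proof (rule cut_free_slope)
    show "cuts \<inter> {p (k - 1)<..<p k} = {}" using unit_partition_gap[OF p(1) k] p(2) by simp
    have "k - 1 \<le> n" "k \<le> n" using k by auto
    then show "0 \<le> p (k - 1)" "p k \<le> 1" using unit_partition_bounds[OF p(1)] by auto
    show "p (k - 1) < p k" by (rule unit_partition_step[OF p(1) k])
  qed
  then show ?thesis using p by blast
qed

lemma piecewise_affine_t: "piecewise_affine t"
proof -
  obtain n p where p: "unit_partition n p" "p ` {..n} = cuts"
    and sl: "\<And>k. k \<in> {1..n} \<Longrightarrow> uniform_slope {p (k - 1)..p k}"
    using cut_partition by blast
  have "affine_fn_on {p (k - 1)..p k} t" if k: "k \<in> {1..n}" for k
  proof -
    obtain m where m: "\<And>y z. y \<in> {p (k - 1)..p k} \<Longrightarrow> z \<in> {p (k - 1)..p k} \<Longrightarrow> t y - t z = m * (y - z)"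
      using sl[OF k] unfolding uniform_slope_def by blast
    have "p k \<in> {p (k - 1)..p k}" using unit_partition_step[OF p(1) k] by simp
    from m[OF _ this] have "t y = m * y + (t (p k) - m * p k)" if "y \<in> {p (k - 1)..p k}" for y
      using that by (force simp: algebra_simps)
    then show ?thesis unfolding affine_fn_on_def affine_with_slope_on_def by blast
  qed
  then show ?thesis using p(1) unfolding piecewise_affine_def by blast
qed

lemma expanding_markov_t:
  assumes c: "1 < c"
    and a: "\<And>i j. i \<in> {1..N} \<Longrightarrow> j \<in> {1..N} \<Longrightarrow> transition_matrix \<sigma> i j = 1 \<Longrightarrow> c \<le> \<bar>a i j\<bar>"
  shows "expanding_markov t"
proof -
  obtain n p where p: "unit_partition n p" "p ` {..n} = cuts"
    and sl: "\<And>k. k \<in> {1..n} \<Longrightarrow> uniform_slope {p (k - 1)..p k}"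
    using cut_partition by blast
  have piece: "monotone_fn_on {p (k - 1)..p k} t \<and>
      (\<forall>y\<in>{p (k - 1)..p k}. \<forall>z\<in>{p (k - 1)..p k}. c * \<bar>y - z\<bar> \<le> \<bar>t y - t z\<bar>)"
    if k: "k \<in> {1..n}" for k
  proof -
    obtain m where m: "c \<le> \<bar>m\<bar>"
      "\<And>y z. y \<in> {p (k - 1)..p k} \<Longrightarrow> z \<in> {p (k - 1)..p k} \<Longrightarrow> t y - t z = m * (y - z)"
      using sl[OF k] a unfolding uniform_slope_def by blast
    have "monotone_fn_on {p (k - 1)..p k} t"
    proof (cases "0 \<le> m")
      case True
      have "mono_on {p (k - 1)..p k} t"
      proof (rule monotone_onI)
        fix y z assume "y \<in> {p (k - 1)..p k}" "z \<in> {p (k - 1)..p k}" "y \<le> z"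
        then show "t y \<le> t z" using m(2)[of z y] mult_nonneg_nonneg[OF True, of "z - y"] by simp
      qed
      then show ?thesis by (simp add: monotone_fn_on_def)
    next
      case False
      have "antimono_on {p (k - 1)..p k} t"
      proof (rule monotone_onI)
        fix y z assume "y \<in> {p (k - 1)..p k}" "z \<in> {p (k - 1)..p k}" "y \<le> z"
        then show "t z \<le> t y" using m(2)[of z y] mult_nonpos_nonneg[of m "z - y"] False by simp
      qed
      then show ?thesis by (simp add: monotone_fn_on_def)
    qed
    moreover have "c * \<bar>y - z\<bar> \<le> \<bar>t y - t z\<bar>" if "y \<in> {p (k - 1)..p k}" "z \<in> {p (k - 1)..p k}" for y z
      unfolding m(2)[OF that] abs_mult using m(1) by (intro mult_right_mono) auto
    ultimately show ?thesis by blast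
  qed
  \<comment> \<open>The endpoints of the pieces are cuts, so all their orbits stay in one finite
    set.\<close>
  have orbit: "(t ^^ k) z \<in> cuts" if "z \<in> cuts" for k z
    by (induction k) (use that image_cuts in auto)
  have "{(t ^^ k) (p i) |k i. i \<le> n} \<subseteq> cuts" using orbit p(2) by blast
  then have "finite {(t ^^ k) (p i) |k i. i \<le> n}" using finite_cuts by (rule finite_subset)
  moreover have "interval_map t" using cont maps_unit by (auto simp: interval_map_def)
  ultimately show ?thesis unfolding expanding_markov_def using p(1) piece c by blast
qed

lemma expanding_system_t:
  assumes c: "1 < c"
    and a: "\<And>i j. i \<in> {1..N} \<Longrightarrow> j \<in> {1..N} \<Longrightarrow> transition_matrix \<sigma> i j = 1 \<Longrightarrow> c \<le> \<bar>a i j\<bar>"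
  shows "expanding_system N \<sigma> x t (\<lambda>_. 1) (inverse c)"
proof
  fix i j y z
  assume ij: "i \<in> {1..N}" "j \<in> {1..N}" "transition_matrix \<sigma> i j = 1"
    and yz: "y \<in> {x (i - 1)..x i}" "z \<in> {x (i - 1)..x i}" "t y \<in> {x (j - 1)..x j}" "t z \<in> {x (j - 1)..x j}"
  have "c * \<bar>y - z\<bar> \<le> \<bar>t y - t z\<bar>"
    unfolding slope[OF ij yz] abs_mult using a[OF ij] by (intro mult_right_mono) auto
  then show "\<bar>y - z\<bar> * 1 \<le> inverse c * 1 * \<bar>t y - t z\<bar>" using c by (simp add: field_simps)
qed (use part cont index_le index_neq t_point t_mono c in \<open>auto simp: inverse_less_1_iff\<close>)

lemma surjective_t:
  assumes col: "\<And>j. j \<in> {1..N} \<Longrightarrow> \<exists>i\<in>{1..N}. transition_matrix \<sigma> i j = 1"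
    and es: "expanding_system N \<sigma> x t u \<kappa>"
  shows "t ` {0..1} = {0..1}"
proof
  show "t ` {0..1} \<subseteq> {0..1}" using maps_unit by blast
  show "{0..1} \<subseteq> t ` {0..1}"
  proof
    fix w :: real assume w: "w \<in> {0..1}"
    obtain j where j: "j \<in> {1..N}" "w \<in> {x (j - 1)..x j}" using unit_partition_cover[OF part w] .
    obtain i where i: "i \<in> {1..N}" "transition_matrix \<sigma> i j = 1" using col[OF j(1)] by blast
    obtain z where "z \<in> {x (i - 1)..x i}" "t z = w"
      using expanding_system.piece_covers[OF es i(1) j(1) i(2) j(2)] by blast
    then show "w \<in> t ` {0..1}" using unit_partition_piece_subset[OF part i(1)] by blast
  qed
qed

end

section \<open>Dyadic cuts, derivatives and invariance of Lebesgue measure\<close>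

lemma dyadic_0: "dyadic 0"
  unfolding dyadic_def by (intro exI[of _ 0]) simp

lemma dyadic_add:
  assumes "dyadic y" "dyadic z"
  shows "dyadic (y + z)"
proof -
  obtain m k m' k' where "y = of_int m / 2 ^ k" "z = of_int m' / 2 ^ k'"
    using assms unfolding dyadic_def by blast
  then have "y + z = of_int (m * 2 ^ k' + m' * 2 ^ k) / 2 ^ (k + k')"
    by (simp add: power_add add_divide_distrib)
  then show ?thesis unfolding dyadic_def by blast
qed

lemma dyadic_mult:
  assumes "dyadic y" "dyadic z"
  shows "dyadic (y * z)"
proof -
  obtain m k m' k' where "y = of_int m / 2 ^ k" "z = of_int m' / 2 ^ k'"
    using assms unfolding dyadic_def by blast
  then have "y * z = of_int (m * m') / 2 ^ (k + k')" by (simp add: power_add)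
  then show ?thesis unfolding dyadic_def by blast
qed

lemma dyadic_minus:
  assumes "dyadic y"
  shows "dyadic (- y)"
proof -
  obtain m k where "y = of_int m / 2 ^ k" using assms unfolding dyadic_def by blast
  then have "- y = of_int (- m) / 2 ^ k" by simp
  then show ?thesis unfolding dyadic_def by blast
qed

lemma dyadic_diff: "dyadic y \<Longrightarrow> dyadic z \<Longrightarrow> dyadic (y - z)"
  using dyadic_add[OF _ dyadic_minus] by fastforce

lemma dyadic_power_int: "dyadic (2 powi k)"
proof (cases "0 \<le> k")
  case True
  then have "(2::real) powi k = of_int (2 ^ nat k) / 2 ^ 0" by (simp add: power_int_def)
  then show ?thesis unfolding dyadic_def by blast
next
  case False
  then have "(2::real) powi k = of_int 1 / 2 ^ nat (- k)" by (simp add: power_int_def power_one_over inverse_eq_divide)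
  then show ?thesis unfolding dyadic_def by blast
qed

lemma dyadic_inverse_signed_power_of_two:
  assumes "signed_power_of_two d"
  shows "dyadic (inverse d)"
proof -
  obtain k where "d = 2 powi k \<or> d = - (2 powi k)" using assms unfolding signed_power_of_two_def by blast
  then have "inverse d = 2 powi (- k) \<or> inverse d = - (2 powi (- k))" by (auto simp: power_int_minus)
  then show ?thesis using dyadic_power_int[of "- k"] dyadic_minus[OF dyadic_power_int[of "- k"]] by auto
qed

text \<open>The exponent is an integer, so exceeding 1 already means reaching 2; this gives one
  expansion constant for all slopes.\<close>

lemma signed_power_of_two_ge_2:
  assumes "signed_power_of_two d" "1 < \<bar>d\<bar>"
  shows "2 \<le> \<bar>d\<bar>"
proof -
  obtain k where k: "d = 2 powi k \<or> d = - (2 powi k)" using assms(1) unfolding signed_power_of_two_def by blast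
  then have abs: "\<bar>d\<bar> = 2 powi k" by auto
  have "1 \<le> k"
  proof (rule ccontr)
    assume "\<not> 1 \<le> k"
    then have "(2::real) powi k \<le> 2 powi 0" by (intro power_int_increasing) auto
    then show False using assms(2) abs by simp
  qed
  then have "(2::real) powi 1 \<le> 2 powi k" by (intro power_int_increasing) auto
  then show ?thesis using abs by simp
qed

section \<open>Lebesgue measure of affine preimages and of partitioned sets\<close>

lemma emeasure_lborel_affine_vimage:
  fixes m c :: real
  assumes m: "m \<noteq> 0" and B: "B \<in> sets borel"
  shows "emeasure lborel ((\<lambda>z. m * z + c) -` B) = ennreal (inverse \<bar>m\<bar>) * emeasure lborel B"
proof -
  let ?L = "\<lambda>z. c + m * z"
  have "emeasure lborel B = emeasure (density (distr lborel borel ?L) (\<lambda>_. ennreal \<bar>m\<bar>)) B"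
    using lborel_real_affine[OF m, of c] by simp
  also have "\<dots> = ennreal \<bar>m\<bar> * emeasure (distr lborel borel ?L) B"
    using B by (subst emeasure_density) (auto simp: nn_integral_cmult_indicator)
  also have "emeasure (distr lborel borel ?L) B = emeasure lborel (?L -` B)"
    using B by (subst emeasure_distr) auto
  finally have "ennreal (inverse \<bar>m\<bar>) * emeasure lborel B
      = (ennreal (inverse \<bar>m\<bar>) * ennreal \<bar>m\<bar>) * emeasure lborel (?L -` B)" by (simp add: mult.assoc)
  also have "ennreal (inverse \<bar>m\<bar>) * ennreal \<bar>m\<bar> = 1"
    using m by (simp add: ennreal_mult[symmetric])
  finally show ?thesis by (simp add: add.commute)
qed

text \<open>Neighbouring closed pieces overlap in single points, which are null sets, so measures
  add up all the same.\<close>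

lemma emeasure_unit_partition:
  assumes x: "unit_partition N x" and B: "B \<in> sets borel" "B \<subseteq> {0..1}"
  shows "(\<Sum>j=1..N. emeasure lborel (B \<inter> {x (j - 1)..x j})) = emeasure lborel B"
proof -
  have "(\<Sum>j=1..k. emeasure lborel (B \<inter> {x (j - 1)..x j})) = emeasure lborel (B \<inter> {0..x k})"
    if "k \<le> N" for k
    using that
  proof (induction k)
    case 0
    have "emeasure lborel (B \<inter> {0..x 0}) \<le> emeasure lborel {0::real}"
      using x B(1) by (intro emeasure_mono) (auto simp: unit_partition_def)
    then show ?case by simp
  next
    case (Suc k)
    have k: "0 \<le> x k" "x k < x (Suc k)"
      using unit_partition_bounds[OF x, of k] unit_partition_less[OF x, of k "Suc k"] Suc.prems by auto
    have "emeasure lborel (B \<inter> {x k..x (Suc k)}) = emeasure lborel (B \<inter> {x k<..x (Suc k)})"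
    proof (rule antisym)
      have "emeasure lborel (B \<inter> {x k..x (Suc k)}) \<le> emeasure lborel ((B \<inter> {x k<..x (Suc k)}) \<union> {x k})"
        using B(1) by (intro emeasure_mono) auto
      also have "\<dots> \<le> emeasure lborel (B \<inter> {x k<..x (Suc k)}) + emeasure lborel {x k}"
        using B(1) by (intro emeasure_subadditive) auto
      finally show "emeasure lborel (B \<inter> {x k..x (Suc k)}) \<le> emeasure lborel (B \<inter> {x k<..x (Suc k)})"
        by simp
      show "emeasure lborel (B \<inter> {x k<..x (Suc k)}) \<le> emeasure lborel (B \<inter> {x k..x (Suc k)})"
        using B(1) by (intro emeasure_mono) auto
    qed
    then have "(\<Sum>j=1..Suc k. emeasure lborel (B \<inter> {x (j - 1)..x j}))
        = emeasure lborel (B \<inter> {0..x k}) + emeasure lborel (B \<inter> {x k<..x (Suc k)})"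
      using Suc by simp
    also have "\<dots> = emeasure lborel ((B \<inter> {0..x k}) \<union> (B \<inter> {x k<..x (Suc k)}))"
      using B(1) by (intro plus_emeasure) auto
    also have "(B \<inter> {0..x k}) \<union> (B \<inter> {x k<..x (Suc k)}) = B \<inter> {0..x (Suc k)}" using k by auto
    finally show ?case .
  qed
  from this[of N] show ?thesis using x B(2) by (simp add: unit_partition_def Int_absorb2)
qed

section \<open>Conditions of the monoid for an associated map\<close>

context associated_system
begin

text \<open>Between consecutive cuts \<open>t\<close> changes by a difference of two partition
  points, which is dyadic; dividing by a signed power of two gives a dyadic step, and the walk
  starts at 0.\<close>

lemma dyadic_cuts:
  assumes dy: "\<And>k. k \<le> N \<Longrightarrow> dyadic (x k)"
    and pow: "\<And>i j. i \<in> {1..N} \<Longrightarrow> j \<in> {1..N} \<Longrightarrow> transition_matrix \<sigma> i j = 1 \<Longrightarrow> signed_power_of_two (a i j)"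
    and z: "z \<in> cuts"
  shows "dyadic z"
proof -
  obtain n p where p: "unit_partition n p" "p ` {..n} = cuts"
    and sl: "\<And>k. k \<in> {1..n} \<Longrightarrow> uniform_slope {p (k - 1)..p k}"
    using cut_partition by blast
  have "dyadic (p k)" if "k \<le> n" for k
    using that
  proof (induction k)
    case 0
    then show ?case using p(1) dyadic_0 by (simp add: unit_partition_def)
  next
    case (Suc k)
    have less: "p k < p (Suc k)" using unit_partition_less[OF p(1)] Suc.prems by simp
    have "uniform_slope {p k..p (Suc k)}" using sl[of "Suc k"] Suc.prems by simp
    then obtain i j where ij: "i \<in> {1..N}" "j \<in> {1..N}" "transition_matrix \<sigma> i j = 1"
      and m: "t (p (Suc k)) - t (p k) = a i j * (p (Suc k) - p k)"
      unfolding uniform_slope_def using less by force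
    have "p k \<in> cuts" "p (Suc k) \<in> cuts" using p(2) Suc.prems by auto
    then have "dyadic (t (p (Suc k)) - t (p k))" by (intro dyadic_diff) (auto simp: cuts_def dy)
    then have "dyadic (p k + (t (p (Suc k)) - t (p k)) * inverse (a i j))"
      using Suc dyadic_inverse_signed_power_of_two[OF pow[OF ij]] by (intro dyadic_add dyadic_mult) auto
    also have "p k + (t (p (Suc k)) - t (p k)) * inverse (a i j) = p (Suc k)"
      using slope_nonzero[OF ij] unfolding m by (simp add: field_simps)
    finally show ?case .
  qed
  then show ?thesis using z unfolding p(2)[symmetric] by blast
qed

lemma differentiable_off_cuts:
  assumes z: "z \<in> {0..1}" "z \<notin> cuts"
  shows "t differentiable (at z within {0..1})"
proof -
  obtain n p where p: "unit_partition n p" "p ` {..n} = cuts"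
    and sl: "\<And>k. k \<in> {1..n} \<Longrightarrow> uniform_slope {p (k - 1)..p k}"
    using cut_partition by blast
  obtain k where k: "k \<in> {1..n}" "z \<in> {p (k - 1)..p k}" using unit_partition_cover[OF p(1) z(1)] .
  have "p (k - 1) \<in> cuts" "p k \<in> cuts" using p(2) k(1) by auto
  then have zk: "z \<in> {p (k - 1)<..<p k}" using k(2) z(2) by (metis atLeastAtMost_iff greaterThanLessThan_iff less_eq_real_def)
  obtain m where m: "\<And>w. w \<in> {p (k - 1)..p k} \<Longrightarrow> t w - t z = m * (w - z)"
    using sl[OF k(1)] k(2) unfolding uniform_slope_def by blast
  have "((\<lambda>w. m * (w - z) + t z) has_real_derivative m) (at z)"
    by (auto intro!: derivative_eq_intros)
  then have "(t has_real_derivative m) (at z)"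
  proof (rule has_field_derivative_transform_within_open)
    show "m * (w - z) + t z = t w" if "w \<in> {p (k - 1)<..<p k}" for w using m[of w] that by auto
  qed (use zk in auto)
  then show ?thesis
    unfolding real_differentiable_def using has_field_derivative_at_within by blast
qed

text \<open>On a closed cut-free interval the one-sided derivatives at the ends equal the slope
  inside. Since \<open>t\<close> is differentiable at every cut in the open interval, the slopes on
  its two sides must agree.\<close>

lemma constant_derivative:
  assumes ab: "0 \<le> b" "b < c" "c \<le> 1" and diff: "t differentiable_on {b<..<c}"
    and pow: "\<And>i j. i \<in> {1..N} \<Longrightarrow> j \<in> {1..N} \<Longrightarrow> transition_matrix \<sigma> i j = 1 \<Longrightarrow> signed_power_of_two (a i j)"
  shows "\<exists>d. signed_power_of_two d \<and> (\<forall>z\<in>{b<..<c}. (t has_real_derivative d) (at z))"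
proof -
  have "\<exists>D. (t has_real_derivative D) (at z)" if "z \<in> {b<..<c}" for z
    using diff that unfolding differentiable_on_def real_differentiable_def
    by (metis at_within_open open_greaterThanLessThan)
  then obtain D where D: "\<And>z. z \<in> {b<..<c} \<Longrightarrow> (t has_real_derivative D z) (at z)" by metis
  have R: "D y = D z \<and> signed_power_of_two (D y)" if yz: "b < y" "y < z" "z < c" for y z
  proof (rule chain_interval[where F = cuts and a = y and b = z
        and R = "\<lambda>y z. D y = D z \<and> signed_power_of_two (D y)", OF finite_cuts yz(2)])
    fix y' z' assume yz': "y \<le> y'" "y' < z'" "z' \<le> z" "cuts \<inter> {y'<..<z'} = {}"
    have "uniform_slope {y'..z'}" by (rule cut_free_slope) (use yz' yz ab in auto)
    then obtain i j where ij: "i \<in> {1..N}" "j \<in> {1..N}" "transition_matrix \<sigma> i j = 1"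
      and m: "\<And>v w. v \<in> {y'..z'} \<Longrightarrow> w \<in> {y'..z'} \<Longrightarrow> t v - t w = a i j * (v - w)"
      unfolding uniform_slope_def by blast
    have "D v = a i j" if v: "v \<in> {y'..z'}" for v
    proof (rule vector_derivative_unique_within_closed_interval[of y' z' v t])
      have "v \<in> {b<..<c}" using v yz' yz by auto
      from D[OF this] show "(t has_vector_derivative D v) (at v within cbox y' z')"
        unfolding has_real_derivative_iff_has_vector_derivative by (rule has_vector_derivative_at_within)
      have "((\<lambda>w. a i j * (w - v) + t v) has_real_derivative a i j) (at v within {y'..z'})"
        by (auto intro!: derivative_eq_intros)
      then have "(t has_real_derivative a i j) (at v within {y'..z'})"
      proof (rule has_field_derivative_transform_within[of _ _ _ _ 1])
        show "a i j * (w - v) + t v = t w" if "w \<in> {y'..z'}" for w using m[OF that v] by simp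
      qed (use v in auto)
      then show "(t has_vector_derivative a i j) (at v within cbox y' z')"
        by (simp add: has_real_derivative_iff_has_vector_derivative)
    qed (use yz' v in auto)
    then have "D y' = a i j" "D z' = a i j" using yz'(2) by auto
    then show "D y' = D z' \<and> signed_power_of_two (D y')" using pow[OF ij] by simp
  qed auto
  define q where "q = (b + c) / 2"
  have q: "b < q" "q < c" using ab by (auto simp: q_def)
  \<comment> \<open>\<open>R\<close> speaks of two distinct points, so \<open>q\<close> is paired
    with some point to its right.\<close>
  have "signed_power_of_two (D q)" using R[OF q(1), of "(q + c) / 2"] q(2) by auto
  moreover have "D z = D q" if "z \<in> {b<..<c}" for z
  proof (cases z q rule: linorder_cases)
    case less
    then show ?thesis using R[of z q] that q(2) by simp
  next
    case greater
    then show ?thesis using R[of q z] that q(1) by simp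
  qed simp
  ultimately show ?thesis using D by metis
qed

text \<open>The part of \<open>B\<close> in piece \<open>j\<close> has a preimage in piece
  \<open>i\<close> of at most \<open>A i j\<close> times its measure, and the entries of a column
  add up to 1. Subadditivity is enough for this direction, so overlaps of the covering sets do no
  harm.\<close>

lemma emeasure_vimage_le:
  assumes stoch: "\<And>j. j \<in> {1..N} \<Longrightarrow> (\<Sum>i=1..N. A i j) = 1"
    and B: "B \<in> sets borel" "B \<subseteq> {0..1}"
  shows "emeasure lborel (t -` B \<inter> {0..1}) \<le> emeasure lborel B"
proof -
  have "\<exists>c. \<forall>z\<in>{x (i - 1)..x i} \<inter> t -` {x (j - 1)..x j}. t z = a i j * z + c"
    if "i \<in> {1..N}" "j \<in> {1..N}" "transition_matrix \<sigma> i j = 1" for i j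
    using t_affine[OF that] unfolding affine_with_slope_on_def .
  then obtain c where c: "\<And>i j z. i \<in> {1..N} \<Longrightarrow> j \<in> {1..N} \<Longrightarrow> transition_matrix \<sigma> i j = 1 \<Longrightarrow>
      z \<in> {x (i - 1)..x i} \<inter> t -` {x (j - 1)..x j} \<Longrightarrow> t z = a i j * z + c i j" by metis
  \<comment> \<open>The affine formula is extended to the whole line, where its preimages scale
    exactly; for an upper bound the excess outside the piece is harmless.\<close>
  define Q where "Q i j = (if transition_matrix \<sigma> i j = 1
      then (\<lambda>z. a i j * z + c i j) -` (B \<inter> {x (j - 1)..x j}) else {})" for i j
  have Q_sets: "Q i j \<in> sets lborel" for i j
  proof -
    have "(\<lambda>z. a i j * z + c i j) \<in> borel_measurable borel" by measurable
    from measurable_sets[OF this, of "B \<inter> {x (j - 1)..x j}"] show ?thesis using B by (simp add: Q_def)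
  qed
  have Q: "emeasure lborel (Q i j) \<le> ennreal (A i j) * emeasure lborel (B \<inter> {x (j - 1)..x j})"
    if "i \<in> {1..N}" "j \<in> {1..N}" for i j
  proof (cases "transition_matrix \<sigma> i j = 1")
    case True
    then show ?thesis unfolding Q_def slope_matrix_def
      using emeasure_lborel_affine_vimage[OF slope_nonzero[OF that True], of "B \<inter> {x (j - 1)..x j}" "c i j"] B
      by simp
  qed (simp add: Q_def)
  have cover: "t -` B \<inter> {0..1} \<subseteq> (\<Union>i\<in>{1..N}. \<Union>j\<in>{1..N}. Q i j)"
  proof
    fix z assume z: "z \<in> t -` B \<inter> {0..1}"
    then have z01: "z \<in> {0..1}" and tz: "t z \<in> B" by auto
    obtain i where i: "i \<in> {1..N}" "z \<in> {x (i - 1)..x i}" using unit_partition_cover[OF part z01] .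
    obtain j where j: "j \<in> {1..N}" "transition_matrix \<sigma> i j = 1" "t z \<in> {x (j - 1)..x j}"
      using image_in_piece[OF i] .
    have eq: "t z = a i j * z + c i j" by (rule c[OF i(1) j(1,2)]) (use i j in auto)
    have "z \<in> Q i j" unfolding Q_def using j(2) tz j(3) by (simp add: eq)
    then show "z \<in> (\<Union>i\<in>{1..N}. \<Union>j\<in>{1..N}. Q i j)" using i(1) j(1) by blast
  qed
  have "emeasure lborel (t -` B \<inter> {0..1}) \<le> emeasure lborel (\<Union>i\<in>{1..N}. \<Union>j\<in>{1..N}. Q i j)"
    using cover Q_sets by (intro emeasure_mono sets.finite_UN) auto
  also have "\<dots> \<le> (\<Sum>i=1..N. emeasure lborel (\<Union>j\<in>{1..N}. Q i j))"
    using Q_sets by (intro emeasure_subadditive_finite) (auto intro!: sets.finite_UN)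
  also have "\<dots> \<le> (\<Sum>i=1..N. \<Sum>j=1..N. emeasure lborel (Q i j))"
    using Q_sets by (intro sum_mono emeasure_subadditive_finite) auto
  also have "\<dots> \<le> (\<Sum>i=1..N. \<Sum>j=1..N. ennreal (A i j) * emeasure lborel (B \<inter> {x (j - 1)..x j}))"
    using Q by (intro sum_mono) auto
  also have "\<dots> = (\<Sum>j=1..N. (\<Sum>i=1..N. ennreal (A i j)) * emeasure lborel (B \<inter> {x (j - 1)..x j}))"
    by (subst sum.swap) (simp add: sum_distrib_right)
  also have "\<dots> = (\<Sum>j=1..N. emeasure lborel (B \<inter> {x (j - 1)..x j}))"
    using stoch A_nonneg by (intro sum.cong refl) (subst sum_ennreal, auto)
  also have "\<dots> = emeasure lborel B" by (rule emeasure_unit_partition[OF part B])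
  finally show ?thesis .
qed

text \<open>The reverse inequality is the same one for the complement, as \<open>[0,1]\<close> has finite measure.\<close>

lemma lambda_preserving_t:
  assumes stoch: "\<And>j. j \<in> {1..N} \<Longrightarrow> (\<Sum>i=1..N. A i j) = 1"
  shows "lambda_preserving t"
  unfolding lambda_preserving_def
proof (intro ballI impI)
  fix B :: "real set" assume B: "B \<in> sets borel" "B \<subseteq> {0..1}"
  have meas: "t -` C \<inter> {0..1} \<in> sets borel" if "C \<in> sets borel" for C
  proof -
    have "t \<in> borel_measurable (restrict_space borel {0..1})"
      by (rule borel_measurable_continuous_on_restrict[OF cont])
    from measurable_sets[OF this that] show ?thesis
      by (auto simp: space_restrict_space sets_restrict_space_iff)
  qed
  have fin: "emeasure lborel C = ennreal (measure lborel C)" if "C \<subseteq> {0..1}" for C :: "real set"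
  proof (rule emeasure_eq_ennreal_measure)
    have "emeasure lborel C \<le> emeasure lborel {0..1::real}" using that by (intro emeasure_mono) auto
    also have "\<dots> = 1" by simp
    finally show "emeasure lborel C \<noteq> top" by (auto simp: top_unique)
  qed
  have le: "measure lborel (t -` C \<inter> {0..1}) \<le> measure lborel C" if "C \<in> sets borel" "C \<subseteq> {0..1}" for C
    using emeasure_vimage_le[OF stoch that] fin[OF that(2)] fin[of "t -` C \<inter> {0..1}"]
    by (simp add: ennreal_le_iff)
  have compl: "measure lborel ({0..1} - C) = 1 - measure lborel C" if "C \<in> sets borel" "C \<subseteq> {0..1}" for C :: "real set"
  proof -
    have "measure lborel ({0..1} - C) = measure lborel {0..1::real} - measure lborel C"
      by (rule measure_Diff) (use that in auto)
    then show ?thesis by simp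
  qed
  have "t -` ({0..1} - B) \<inter> {0..1} = {0..1} - (t -` B \<inter> {0..1})" using maps_unit by auto
  then have "1 - measure lborel (t -` B \<inter> {0..1}) \<le> 1 - measure lborel B"
    using le[of "{0..1} - B"] compl[OF B] compl[OF meas[OF B(1)]] B by auto
  then have "measure lborel (t -` B \<inter> {0..1}) = measure lborel B" using le[OF B] by linarith
  then show "emeasure lborel B = emeasure lborel (t -` B \<inter> {0..1})"
    using fin[OF B(2)] fin[of "t -` B \<inter> {0..1}"] by simp
qed

end

section \<open>Existence and uniqueness\<close>

text \<open>A second positive entry in the same column leaves less than 1 for
  \<open>A i j\<close>.\<close>

lemma (in slope_family) slope_gt_1:
  assumes column: "(\<Sum>i=1..N. transition_matrix \<sigma> i j) > 1" and stoch: "(\<Sum>i=1..N. A i j) = 1"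
    and ij: "i \<in> {1..N}" "j \<in> {1..N}" "transition_matrix \<sigma> i j = 1"
  shows "1 < \<bar>a i j\<bar>"
proof -
  have "\<exists>k\<in>{1..N}. k \<noteq> i \<and> transition_matrix \<sigma> k j = 1"
  proof (rule ccontr)
    assume none: "\<not> (\<exists>k\<in>{1..N}. k \<noteq> i \<and> transition_matrix \<sigma> k j = 1)"
    then have "(\<Sum>k=1..N. transition_matrix \<sigma> k j) = (\<Sum>k=1..N. if k = i then 1 else 0)"
      using ij(3) by (intro sum.cong refl) (auto simp: transition_matrix_def split: if_splits)
    then show False using column ij(1) by simp
  qed
  then obtain k where k: "k \<in> {1..N}" "k \<noteq> i" "transition_matrix \<sigma> k j = 1" by blast
  have "A i j + A k j = (\<Sum>i\<in>{i, k}. A i j)" using k(2) by simp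
  also have "\<dots> \<le> (\<Sum>i=1..N. A i j)" using ij k A_nonneg by (intro sum_mono2) auto
  finally have "A i j < 1" using A_pos[OF k(1) ij(2) k(3)] stoch by linarith
  then have "inverse \<bar>a i j\<bar> < 1" using ij(3) by (simp add: slope_matrix_def)
  moreover have "0 < \<bar>a i j\<bar>" using A_pos[OF ij] ij(3) by (simp add: slope_matrix_def)
  ultimately show ?thesis by (simp add: inverse_less_1_iff)
qed

lemma (in associated_system) associated_map_t: "associated_map N \<sigma> a t"
proof -
  have "interval_map t" using cont maps_unit by (auto simp: interval_map_def)
  then show ?thesis unfolding associated_map_def using part t_point t_mono t_affine by blast
qed

text \<open>The partition is normalised beyond \<open>N\<close> so that it becomes unique as a function.\<close>

lemma associated_map_system:
  assumes t: "associated_map N \<sigma> a t"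
    and le: "\<And>i. i \<le> N \<Longrightarrow> \<sigma> i \<le> N"
    and neq: "\<And>i. i \<in> {1..N} \<Longrightarrow> \<sigma> (i - 1) \<noteq> \<sigma> i"
    and admissible: "admissible_slopes N \<sigma> a"
  obtains x where "associated_system N \<sigma> a x t" "\<And>k. N < k \<Longrightarrow> x k = 0"
proof -
  obtain y where y: "unit_partition N y" "\<And>i. i \<le> N \<Longrightarrow> t (y i) = y (\<sigma> i)"
    "\<And>i. i \<in> {1..N} \<Longrightarrow> monotone_fn_on {y (i - 1)..y i} t"
    "\<And>i j. i \<in> {1..N} \<Longrightarrow> j \<in> {1..N} \<Longrightarrow> transition_matrix \<sigma> i j = 1 \<Longrightarrow>
       affine_with_slope_on (a i j) ({y (i - 1)..y i} \<inter> t -` {y (j - 1)..y j}) t"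
    using t unfolding associated_map_def by blast
  define x where "x k = (if k \<le> N then y k else 0)" for k
  have xy: "x i = y i" if "i \<le> N" for i using that by (simp add: x_def)
  have piece: "{x (i - 1)..x i} = {y (i - 1)..y i}" if "i \<in> {1..N}" for i
  proof -
    have "i \<le> N" "i - 1 \<le> N" using that by auto
    then show ?thesis by (simp only: xy)
  qed
  have "associated_system N \<sigma> a x t"
  proof
    show "unit_partition N x" using y(1) by (simp add: unit_partition_def x_def)
    show "continuous_on {0..1} t" using t by (simp add: associated_map_def interval_map_def)
    show "t (x i) = x (\<sigma> i)" if "i \<le> N" for i using y(2)[OF that] xy le that by simp
    show "monotone_fn_on {x (i - 1)..x i} t" if "i \<in> {1..N}" for i
      using y(3)[OF that] unfolding piece[OF that] .
    show "affine_with_slope_on (a i j) ({x (i - 1)..x i} \<inter> t -` {x (j - 1)..x j}) t"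
      if "i \<in> {1..N}" "j \<in> {1..N}" "transition_matrix \<sigma> i j = 1" for i j
      using y(4)[OF that] unfolding piece[OF that(1)] piece[OF that(2)] .
  qed (use le neq admissible in auto)
  then show thesis using that by (simp add: x_def)
qed

lemma associated_map_unique:
  assumes t: "associated_map N \<sigma> a t" and t': "associated_map N \<sigma> a t'"
    and le: "\<And>i. i \<le> N \<Longrightarrow> \<sigma> i \<le> N"
    and neq: "\<And>i. i \<in> {1..N} \<Longrightarrow> \<sigma> (i - 1) \<noteq> \<sigma> i"
    and admissible: "admissible_slopes N \<sigma> a"
    and irred: "irreducible_matrix N (transition_matrix \<sigma>)"
    and z: "z \<in> {0..1}"
  shows "t z = t' z"
proof -
  obtain x where x: "associated_system N \<sigma> a x t" "\<And>k. N < k \<Longrightarrow> x k = 0"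
    using associated_map_system[OF t le neq admissible] by blast
  obtain x' where x': "associated_system N \<sigma> a x' t'" "\<And>k. N < k \<Longrightarrow> x' k = 0"
    using associated_map_system[OF t' le neq admissible] by blast
  interpret T: associated_system N \<sigma> a x t by (rule x(1))
  interpret T': associated_system N \<sigma> a x' t' by (rule x'(1))
  have total: "(\<Sum>i=1..N. y i - y (i - 1)) = 1" if "unit_partition N y" for y
    using sum_partition_telescope[of 0 N y] that by (simp add: unit_partition_def)
  have lengths: "x i - x (i - 1) = x' i - x' (i - 1)" if "i \<in> {1..N}" for i
  proof (rule irreducible_fixed_vector_unique[where A = T.A and v = "\<lambda>i. x i - x (i - 1)"
        and w = "\<lambda>i. x' i - x' (i - 1)", OF irred unit_partition_pos[OF T.part]])
    show "0 < x' i - x' (i - 1)" if "i \<in> {1..N}" for i using unit_partition_step[OF T'.part that] by simp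
  qed (assumption | rule T.A_nonneg T.A_pos T.lengths_fixpt T'.lengths_fixpt total T.part T'.part that)+
  have eq: "x k = x' k" if "k \<le> N" for k
  proof -
    have "x k - x 0 = (\<Sum>j=1..k. x j - x (j - 1))" using sum_partition_telescope[of 0 k x] by simp
    also have "\<dots> = (\<Sum>j=1..k. x' j - x' (j - 1))" using lengths that by (intro sum.cong) auto
    also have "\<dots> = x' k - x' 0" using sum_partition_telescope[of 0 k x'] by simp
    finally show ?thesis using T.part T'.part by (simp add: unit_partition_def)
  qed
  \<comment> \<open>Equality as functions identifies the predicates \<open>branch\<close> of the two
    interpretations, so that \<open>T.branch_unique\<close> applies to both maps.\<close>
  have "x = x'"
  proof
    show "x k = x' k" for k using eq[of k] x(2)[of k] x'(2)[of k] by (cases "k \<le> N") auto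
  qed
  obtain i where i: "i \<in> {1..N}" "z \<in> {x (i - 1)..x i}" using unit_partition_cover[OF T.part z] .
  show ?thesis
    using T.branch_unique[OF i(1) T.branch_t[OF i]] T'.branch_t[OF i(1)] i(2) \<open>x = x'\<close> by blast
qed

lemma associated_system_exists:
  fixes v :: "nat \<Rightarrow> real"
  assumes N: "0 < N" and le: "\<And>i. i \<le> N \<Longrightarrow> \<sigma> i \<le> N"
    and neq: "\<And>i. i \<in> {1..N} \<Longrightarrow> \<sigma> (i - 1) \<noteq> \<sigma> i"
    and admissible: "admissible_slopes N \<sigma> a"
    and v: "\<And>i. i \<in> {1..N} \<Longrightarrow> v i = (\<Sum>j=1..N. slope_matrix \<sigma> a i j * v j)"
      "(\<Sum>i=1..N. v i) = 1" "\<And>i. i \<in> {1..N} \<Longrightarrow> v i > 0"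
  shows "\<exists>t\<in>extensional {0..1}. associated_system N \<sigma> a (\<lambda>k. \<Sum>j=1..k. v j) t"
proof -
  define x where "x k = (\<Sum>j=1..k. v j)" for k
  have diff: "x i - x (i - 1) = v i" if i: "i \<in> {1..N}" for i
  proof -
    obtain m where "i = Suc m" using i by (cases i) auto
    then show ?thesis by (simp add: x_def)
  qed
  have part: "unit_partition N x"
    unfolding unit_partition_def
  proof (intro conjI allI impI)
    show "x 0 = 0" "x N = 1" using v(2) by (simp_all add: x_def)
    show "x i < x (Suc i)" if "i < N" for i using v(3)[of "Suc i"] that by (simp add: x_def)
  qed
  interpret S: slope_family N \<sigma> a x by unfold_locales (fact part le neq admissible)+
  have fixpt: "x i - x (i - 1) = (\<Sum>j=1..N. S.A i j * (x j - x (j - 1)))" if "i \<in> {1..N}" for i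
    using v(1)[OF that] diff that by simp
  obtain t0 where t0: "\<And>k. k \<le> N \<Longrightarrow> t0 (x k) = x (\<sigma> k)"
    "\<And>i z. i \<in> {1..N} \<Longrightarrow> z \<in> {x (i - 1)..x i} \<Longrightarrow> S.branch i z (t0 z)"
    using S.associated_exists[OF fixpt] by blast
  \<comment> \<open>This fixes the values outside the unit interval, which the conditions on an
    associated map leave open.\<close>
  define t where "t = restrict t0 {0..1}"
  have t: "S.branch i z (t z)" if "i \<in> {1..N}" "z \<in> {x (i - 1)..x i}" for i z
    using t0(2)[OF that] unit_partition_piece_subset[OF part that(1)] that(2) by (auto simp: t_def)
  have "associated_system N \<sigma> a x t"
  proof
    show "continuous_on {0..1} t"
      using S.branch_continuous t fixpt by (intro continuous_on_unit_partition[OF part]) blast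
    show "t (x i) = x (\<sigma> i)" if "i \<le> N" for i
      using t0(1)[OF that] unit_partition_bounds[OF part that] by (simp add: t_def)
    show "monotone_fn_on {x (i - 1)..x i} t" if "i \<in> {1..N}" for i
      using S.branch_monotone[OF that] t[OF that] by blast
    show "affine_with_slope_on (a i j) ({x (i - 1)..x i} \<inter> t -` {x (j - 1)..x j}) t"
      if "i \<in> {1..N}" "j \<in> {1..N}" "transition_matrix \<sigma> i j = 1" for i j
      using S.branch_affine[OF that] t[OF that(1)] by blast
  qed
  then show ?thesis unfolding x_def[abs_def] t_def by blast
qed

text \<open>A map of the unit interval is represented by a function on all reals, so uniqueness is
  meaningful only for the representative with default values outside; this is the role of the
  extensional function space. In the linear case affinity on the pieces of \<open>xh\<close>
  determines the stretching factor of each branch.\<close>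

theorem corollary47:
  fixes s :: "real \<Rightarrow> real" and N :: nat and xh :: "nat \<Rightarrow> real"
    and \<sigma> :: "nat \<Rightarrow> nat" and a :: "nat \<Rightarrow> nat \<Rightarrow> real"
  assumes markov: "linear_markov s \<and> (\<forall>i\<in>{1..N}. affine_fn_on {xh (i - 1)..xh i} s)
                   \<or> expanding_markov s"
    and part: "unit_partition N xh"
    and invariant: "\<forall>i\<le>N. \<exists>j\<le>N. s (xh i) = xh j"
    and pieces: "\<forall>i\<in>{1..N}. monotone_fn_on {xh (i - 1)..xh i} s"
    and index: "\<sigma> = index_map N xh s"
    and irred: "irreducible_matrix N (transition_matrix \<sigma>)"
    and columns: "\<forall>j\<in>{1..N}. (\<Sum>i=1..N. transition_matrix \<sigma> i j) > 1"
    and admissible: "admissible_slopes N \<sigma> a"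
    and powers: "\<forall>i\<in>{1..N}. \<forall>j\<in>{1..N}. transition_matrix \<sigma> i j = 1 \<longrightarrow>
                   signed_power_of_two (a i j)"
    and stochastic: "\<forall>j\<in>{1..N}. (\<Sum>i=1..N. slope_matrix \<sigma> a i j) = 1"
    and solution: "\<exists>v :: nat \<Rightarrow> real.
                     (\<forall>i\<in>{1..N}. v i = (\<Sum>j=1..N. slope_matrix \<sigma> a i j * v j)) \<and>
                     (\<Sum>i=1..N. v i) = 1 \<and>
                     (\<forall>i\<in>{1..N}. v i > 0) \<and>
                     (\<forall>i\<in>{1..N}. dyadic (v i))"
  shows "\<exists>!t. t \<in> {0..1} \<rightarrow>\<^sub>E {0..1} \<and> associated_map N \<sigma> a t \<and>
           expanding_markov t \<and> t \<in> lambda_Thompson_monoid \<and> topologically_conjugate t s"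
proof -
  have idx: "\<sigma> i \<le> N" "s (xh i) = xh (\<sigma> i)" if "i \<le> N" for i
    using index_map[OF part, of s i] invariant that unfolding index by auto
  have neq: "\<sigma> (i - 1) \<noteq> \<sigma> i" if "i \<in> {1..N}" for i by (rule index_map_neq[OF irred columns that])
  have N: "0 < N" by (rule unit_partition_pos[OF part])
  have pow: "signed_power_of_two (a i j)"
    if "i \<in> {1..N}" "j \<in> {1..N}" "transition_matrix \<sigma> i j = 1" for i j
    using powers that by blast
  have "\<exists>u \<kappa>. expanding_system N \<sigma> xh s u \<kappa>"
    using markov
  proof
    assume lin: "linear_markov s \<and> (\<forall>i\<in>{1..N}. affine_fn_on {xh (i - 1)..xh i} s)"
    then have cont: "continuous_on {0..1} s" by (simp add: linear_markov_def interval_map_def)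
    show ?thesis
      by (rule linear_expanding_system[OF part cont _ _ _ _ irred columns]) (use idx pieces lin in blast)+
  next
    assume exp: "expanding_markov s"
    show ?thesis
      by (rule expanding_markov_expanding_system[where \<sigma> = \<sigma>, OF part exp]) (use idx pieces neq in blast)+
  qed
  then obtain u \<kappa> where s: "expanding_system N \<sigma> xh s u \<kappa>" by blast
  obtain v :: "nat \<Rightarrow> real" where v: "\<And>i. i \<in> {1..N} \<Longrightarrow> v i = (\<Sum>j=1..N. slope_matrix \<sigma> a i j * v j)"
    "(\<Sum>i=1..N. v i) = 1" "\<And>i. i \<in> {1..N} \<Longrightarrow> v i > 0" "\<And>i. i \<in> {1..N} \<Longrightarrow> dyadic (v i)"
    using solution by blast
  define x where "x k = (\<Sum>j=1..k. v j)" for k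
  obtain t where ext: "t \<in> extensional {0..1}" and t: "associated_system N \<sigma> a x t"
    using associated_system_exists[OF N idx(1) neq admissible v(1-3)] unfolding x_def[abs_def] by blast
  interpret T: associated_system N \<sigma> a x t by (rule t)
  have two: "2 \<le> \<bar>a i j\<bar>"
    if ij: "i \<in> {1..N}" "j \<in> {1..N}" "transition_matrix \<sigma> i j = 1" for i j
  proof (rule signed_power_of_two_ge_2[OF pow[OF ij]])
    show "1 < \<bar>a i j\<bar>" by (rule T.slope_gt_1) (use columns stochastic ij in auto)
  qed
  have sys: "expanding_system N \<sigma> x t (\<lambda>_. 1) (inverse 2)"
    by (rule T.expanding_system_t) (use two in auto)
  have "dyadic (x k)" if "k \<le> N" for k
    using that
  proof (induction k)
    case 0
    then show ?case using dyadic_0 by (simp add: x_def)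
  next
    case (Suc k)
    then show ?case using dyadic_add[of "x k" "v (Suc k)"] v(4)[of "Suc k"] by (simp add: x_def)
  qed
  then have dyadic: "dyadic z" if "z \<in> T.cuts" for z using T.dyadic_cuts pow that by blast
  have surj: "t ` {0..1} = {0..1}"
  proof (rule T.surjective_t[OF _ sys], rule ccontr)
    fix j assume j: "j \<in> {1..N}" and none: "\<not> (\<exists>i\<in>{1..N}. transition_matrix \<sigma> i j = 1)"
    have "(\<Sum>i=1..N. transition_matrix \<sigma> i j) = 0"
      using none by (intro sum.neutral) (auto simp: transition_matrix_def split: if_splits)
    moreover have "(\<Sum>i=1..N. transition_matrix \<sigma> i j) > 1" using columns j by blast
    ultimately show False by linarith
  qed
  have off: "z \<in> T.cuts" if "z \<in> {0..1}" "\<not> t differentiable (at z within {0..1})" for z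
    using T.differentiable_off_cuts that by blast
  have thompson: "t \<in> lambda_Thompson_monoid"
    unfolding lambda_Thompson_monoid_def mem_Collect_eq
  proof (intro conjI allI impI ballI)
    show "continuous_on {0..1} t" by (rule T.cont)
    show "t ` {0..1} = {0..1}" by (rule surj)
    show "lambda_preserving t" by (rule T.lambda_preserving_t) (use stochastic in auto)
    show "piecewise_affine t" by (rule T.piecewise_affine_t)
    show "finite {z \<in> {0..1}. \<not> t differentiable (at z within {0..1})}"
      by (rule finite_subset[OF _ T.finite_cuts]) (use off in blast)
    show "dyadic z" if "z \<in> {0..1}" "\<not> t differentiable (at z within {0..1})" for z
      using dyadic off that by blast
    show "\<exists>d. signed_power_of_two d \<and> (\<forall>z\<in>{b<..<c}. (t has_real_derivative d) (at z))"
      if "0 \<le> b \<and> b < c \<and> c \<le> 1 \<and> t differentiable_on {b<..<c}" for b c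
      using T.constant_derivative[of b c] that pow by blast
  qed
  have maps: "t \<in> {0..1} \<rightarrow>\<^sub>E {0..1}" using ext T.maps_unit by (auto simp: PiE_def)
  have markov_t: "expanding_markov t" by (rule T.expanding_markov_t[of 2]) (use two in auto)
  have conj: "topologically_conjugate t s" by (rule expanding_systems_conjugate[OF sys s])
  \<comment> \<open>Being associated with the data already determines the map on the unit interval;
    the function space determines it elsewhere.\<close>
  have unique: "t' = t" if "t' \<in> {0..1} \<rightarrow>\<^sub>E {0..1}" "associated_map N \<sigma> a t'" for t'
  proof (rule extensionalityI[of _ "{0..1}"])
    show "t' z = t z" if "z \<in> {0..1}" for z
      by (rule associated_map_unique[OF \<open>associated_map N \<sigma> a t'\<close> T.associated_map_t])
        (use idx(1) neq admissible irred that in auto)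
  qed (use that ext in \<open>auto simp: PiE_def\<close>)
  show ?thesis
    by (rule ex1I[of _ t]) (use maps T.associated_map_t markov_t thompson conj in blast, use unique in blast)
qed

end
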